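(* A weakly modular graph $G=(V,E)$ is strongly smooth if and only if $G$ contains none of the graphs $W_4^-$, $K_{2,3}$, $K^+_{2,3}$, $R_1$ as an isometric subgraph.
   Context: All graphs are undirected, connected, without loops or multiple edges, and not necessarily finite. $d=d_G$ is the shortest-path distance. The interval is $I(u,v):=\{x\in V: d(u,x)+d(x,v)=d(u,v)\}$. A set $A\subseteq V$ is convex if $I(x,y)\subseteq A$ for all $x,y\in A$; $\mathrm{conv}(S)$ is the smallest convex set containing $S$. The point-shadow of $v$ with respect to $u$ is $v/u:=\{x\in V: v\in \mathrm{conv}(\{u,x\})\}$. $G$ is strongly smooth if $v/u$ is convex for all $u,v\in V$. $G$ is weakly modular if it satisfies: (TC) for any $u,v,s\in V$ with $d(u,v)=1$ and $d(u,s)=d(v,s)$, there is a common neighbor $x$ of $u$ and $v$ with $d(s,x)=d(s,u)-1$; (QC) for any $u,v,w,s\in V$ with $d(u,w)=d(v,w)=1$, $d(u,v)=2$ and $d(s,u)=d(s,v)=d(s,w)-1$, there is a common neighbor $x$ of $u$ and $v$ with $d(s,x)=d(s,u)-1$. $G$ contains a graph $H$ as an isometric subgraph if there is a map $f:V(H)\to V$ with $d_G(f(x),f(y))=d_H(x,y)$ for all $x,y\in V(H)$. The graphs are: - $W_4^-$: vertices $u,v,x,y,w$; edges $ux, xw, wy, yu, uv, vx, vy$ (a 4-cycle $uxwy$ plus a vertex $v$ adjacent to exactly three of its vertices). - $K_{2,3}$: the complete bipartite graph with parts of sizes 2 and 3. - $K_{2,3}^+$ (the propeller): $K_{2,3}$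 plus an edge joining the two vertices of degree 3. - $R_1$: vertices $u,v,x,a,b,w,y$; edges $uv, vx, xa, ay, yw, wb, bu, vb, ba, aw, wx, xb, va$. *)

theory Defs
  imports "Graph_Theory.Digraph_Component"
begin

text \<open>
  An undirected graph without loops or multiple edges is a symmetric, loop-free
  \<^typ>\<open>'a pair_pre_digraph\<close> (locale \<^locale>\<open>pair_bidirected_digraph\<close>; no finiteness is assumed):
  each edge is represented by its two orientations. The library's \<^const>\<open>connected\<close> includes
  that the vertex set is nonempty.
\<close>

definition connected_simple_graph :: "'a pair_pre_digraph \<Rightarrow> bool" where
  "connected_simple_graph G \<longleftrightarrow> pair_bidirected_digraph G \<and> connected (with_proj G)"

text \<open>Without a path between the two vertices the value below is unspecified.\<close>

definition gdist :: "'a pair_pre_digraph \<Rightarrow> 'a \<Rightarrow> 'a \<Rightarrow> nat" where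
  "gdist G u v = (LEAST n. \<exists>p. pre_digraph.apath (with_proj G) u p v \<and> length p = n)"

definition interval :: "'a pair_pre_digraph \<Rightarrow> 'a \<Rightarrow> 'a \<Rightarrow> 'a set" where
  "interval G u v = {x \<in> pverts G. gdist G u x + gdist G x v = gdist G u v}"

definition geod_convex :: "'a pair_pre_digraph \<Rightarrow> 'a set \<Rightarrow> bool" where
  "geod_convex G A \<longleftrightarrow> A \<subseteq> pverts G \<and> (\<forall>x\<in>A. \<forall>y\<in>A. interval G x y \<subseteq> A)"

definition conv :: "'a pair_pre_digraph \<Rightarrow> 'a set \<Rightarrow> 'a set" where
  "conv G S = geod_convex G hull S"

text \<open>\<open>shadow G v u\<close> is the point-shadow \<open>v/u\<close> of \<open>v\<close> with respect to \<open>u\<close>.\<close>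

definition shadow :: "'a pair_pre_digraph \<Rightarrow> 'a \<Rightarrow> 'a \<Rightarrow> 'a set" where
  "shadow G v u = {x \<in> pverts G. v \<in> conv G {u, x}}"

definition strongly_smooth :: "'a pair_pre_digraph \<Rightarrow> bool" where
  "strongly_smooth G \<longleftrightarrow> (\<forall>u\<in>pverts G. \<forall>v\<in>pverts G. geod_convex G (shadow G v u))"

text \<open>
  In the next two conditions \<open>d(s,a) = d(s,b) - 1\<close> is written \<open>d(s,a) + 1 = d(s,b)\<close>,
  to avoid truncated subtraction.
\<close>

definition triangle_condition :: "'a pair_pre_digraph \<Rightarrow> bool" where
  "triangle_condition G \<longleftrightarrow>
     (\<forall>u\<in>pverts G. \<forall>v\<in>pverts G. \<forall>s\<in>pverts G.
        gdist G u v = 1 \<and> gdist G u s = gdist G v s \<longrightarrow>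
        (\<exists>x\<in>pverts G. (u, x) \<in> parcs G \<and> (v, x) \<in> parcs G \<and>
           gdist G s x + 1 = gdist G s u))"

definition quadrangle_condition :: "'a pair_pre_digraph \<Rightarrow> bool" where
  "quadrangle_condition G \<longleftrightarrow>
     (\<forall>u\<in>pverts G. \<forall>v\<in>pverts G. \<forall>w\<in>pverts G. \<forall>s\<in>pverts G.
        gdist G u w = 1 \<and> gdist G v w = 1 \<and> gdist G u v = 2 \<and>
        gdist G s u = gdist G s v \<and> gdist G s v + 1 = gdist G s w \<longrightarrow>
        (\<exists>x\<in>pverts G. (u, x) \<in> parcs G \<and> (v, x) \<in> parcs G \<and>
           gdist G s x + 1 = gdist G s u))"

definition weakly_modular :: "'a pair_pre_digraph \<Rightarrow> bool" where
  "weakly_modular G \<longleftrightarrow> triangle_condition G \<and> quadrangle_condition G"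

text \<open>The map \<open>f\<close> is automatically injective on the vertices of a connected graph \<open>H\<close>.\<close>

definition contains_isometric :: "'a pair_pre_digraph \<Rightarrow> 'b pair_pre_digraph \<Rightarrow> bool" where
  "contains_isometric G H \<longleftrightarrow>
     (\<exists>f. f ` pverts H \<subseteq> pverts G \<and>
        (\<forall>x\<in>pverts H. \<forall>y\<in>pverts H. gdist G (f x) (f y) = gdist H x y))"

datatype label = LU | LV | LX | LY | LW | LA | LB

definition graph_of_edges :: "'b rel \<Rightarrow> 'b pair_pre_digraph" where
  "graph_of_edges r = \<lparr>pverts = Field r, parcs = r \<union> r\<inverse>\<rparr>"

definition W4_minus :: "label pair_pre_digraph" where
  "W4_minus = graph_of_edges {(LU,LX), (LX,LW), (LW,LY), (LY,LU), (LU,LV), (LV,LX), (LV,LY)}"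

definition K23 :: "label pair_pre_digraph" where
  "K23 = graph_of_edges ({LU, LV} \<times> {LX, LY, LW})"

definition K23_plus :: "label pair_pre_digraph" where
  "K23_plus = graph_of_edges (insert (LU,LV) ({LU, LV} \<times> {LX, LY, LW}))"

definition R1 :: "label pair_pre_digraph" where
  "R1 = graph_of_edges
     {(LU,LV), (LV,LX), (LX,LA), (LA,LY), (LY,LW), (LW,LB), (LB,LU), (LV,LB), (LB,LA), (LA,LW), (LW,LX), (LX,LB), (LV,LA)}"

end

theory Submission
  imports Defs
begin

text \<open>
  Suppose that \<open>G\<close> is strongly smooth. In each of the four graphs some shadow contains two vertices at
  distance two but misses one of their common neighbours. For \<open>K_{2,3}\<close>, \<open>W_4\<^sup>-\<close> and the propeller the
  missing vertex is adjacent to the vertex from which the shadow is cast, and an edge is its own hull.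
  For \<open>R_1\<close> one needs in addition that intervals of length two are convex, which holds once \<open>K_{2,3}\<close>
  and \<open>W_4\<^sup>-\<close> are excluded.

  For the converse, the key is that all intervals are convex when \<open>K_{2,3}\<close>, \<open>W_4\<^sup>-\<close> and \<open>R_1\<close> are
  excluded (\<open>interval_convex\<close>). Then the hull of a pair is its interval, and \<open>v/u\<close> is the set of all \<open>x\<close>
  with \<open>v \<in> I(u,x)\<close>. Excluding the propeller makes these sets convex (\<open>shadow_convex\<close>).

  Both steps use that in a weakly modular graph a starshaped set is convex as soon as it contains the
  common neighbours of any two of its vertices at distance two (\<open>convex_if_starshaped_two_convex\<close>).
  The remaining local analysis compares the distances of the vertices involved from \<open>u\<close> and from \<open>v\<close>,
  called their levels. The triangle and quadrangle conditions supply common neighbours on a lower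
  level, and \<open>nonadjacent_common_neighbours\<close> (two nonadjacent vertices have no three common neighbours
  with fewer than two edges among them) forces enough adjacencies for a contradiction. For intervals
  exactly one configuration, called a corner, resists this, and it unfolds into a copy of \<open>R_1\<close>
  (\<open>corner_contains_R1\<close>).
\<close>

section \<open>Distances and walks\<close>

lemma (in pair_wf_digraph) awalk_iff_relpow:
  "(\<exists>p. awalk u p v \<and> length p = n) \<longleftrightarrow> u \<in> pverts G \<and> (u, v) \<in> parcs G ^^ n"
proof (induction n arbitrary: u)
  case 0
  show ?case by (auto simp: awalk_Nil_iff)
next
  case (Suc n)
  have "(\<exists>p. awalk u p v \<and> length p = Suc n) \<longleftrightarrow>
      (\<exists>w. (u, w) \<in> parcs G \<and> (\<exists>p. awalk w p v \<and> length p = n))"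
  proof (intro iffI; elim exE conjE)
    fix p assume p: "awalk u p v" "length p = Suc n"
    then obtain e q where "p = e # q" by (cases p) auto
    with p have "(u, snd e) \<in> parcs G" "awalk (snd e) q v" "length q = n"
      by (auto simp: awalk_Cons_iff)
    then show "\<exists>w. (u, w) \<in> parcs G \<and> (\<exists>p. awalk w p v \<and> length p = n)"
      by blast
  next
    fix w p assume "(u, w) \<in> parcs G" "awalk w p v" "length p = n"
    then show "\<exists>p. awalk u p v \<and> length p = Suc n"
      by (intro exI[of _ "(u, w) # p"]) (simp add: awalk_Cons_iff)
  qed
  also have "\<dots> \<longleftrightarrow> u \<in> pverts G \<and> (u, v) \<in> parcs G ^^ Suc n"
    unfolding Suc.IH by (metis in_arcsD1 in_arcsD2 relpow_Suc_D2 relpow_Suc_I2)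
  finally show ?case .
qed

lemma (in pair_wf_digraph) awalk_shorten_to_apath:
  assumes "awalk u p v"
  shows "\<exists>q. apath u q v \<and> length q \<le> length p"
  using assms
proof (induction rule: awalk_to_apath_induct)
  case (path p)
  then show ?case unfolding apath_def by auto
next
  case (decomp p q r s)
  have "is_awalk_cyc_decomp p (q, r, s)"
    using awalk_cyc_decomp_has_prop[OF decomp(1,3)] decomp(2) by simp
  then have "length (q @ s) \<le> length p" by auto
  then show ?case using decomp.IH le_trans by blast
qed

text \<open>Distances are defined by paths without repeated vertices. Relation powers count arbitrary walks
  and need no list of arcs, so all metric facts below go through this reformulation.\<close>

lemma (in pair_wf_digraph) gdist_eq_Least:
  assumes "u \<in> pverts G" and "(u, v) \<in> (parcs G)\<^sup>*"
  shows "gdist G u v = (LEAST n. (u, v) \<in> parcs G ^^ n)"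
proof -
  let ?W = "\<lambda>n. (u, v) \<in> parcs G ^^ n"
  let ?P = "\<lambda>n. \<exists>p. apath u p v \<and> length p = n"
  have shorten: "\<exists>m\<le>n. ?P m" if "?W n" for n
    using that assms(1) awalk_iff_relpow[of u v n] awalk_shorten_to_apath by metis
  have walk: "?W n" if "?P n" for n
    using that awalk_iff_relpow[of u v n] unfolding apath_def by blast
  obtain n where "?W n" using assms(2) rtrancl_imp_relpow by blast
  then have W: "?W (Least ?W)" by (rule LeastI)
  then obtain m where m: "m \<le> Least ?W" "?P m" using shorten by blast
  have "Least ?P = Least ?W"
  proof (rule antisym)
    show "Least ?P \<le> Least ?W" using Least_le[of ?P m] m by simp
    have "?P (Least ?P)" using m(2) by (rule LeastI[of ?P])
    then show "Least ?W \<le> Least ?P" by (rule Least_le[OF walk])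
  qed
  then show ?thesis unfolding gdist_def by simp
qed

text \<open>Connectedness is kept as reachability along \<open>parcs G\<close>, which is easy to check for the explicit
  small graphs as well as for the ambient graph.\<close>

locale connected_graph = pair_bidirected_digraph G for G :: "'a pair_pre_digraph" +
  assumes reach: "\<lbrakk>u \<in> pverts G; v \<in> pverts G\<rbrakk> \<Longrightarrow> (u, v) \<in> (parcs G)\<^sup>*"
begin

abbreviation "V \<equiv> pverts G"
abbreviation "d \<equiv> gdist G"
abbreviation I where "I \<equiv> interval G"
abbreviation adj (infix "\<sim>" 50) where "x \<sim> y \<equiv> (x, y) \<in> parcs G"

lemma adj_sym: "x \<sim> y \<Longrightarrow> y \<sim> x"
  by (rule arcs_symmetric)

lemma adj_irrefl [simp]: "\<not> x \<sim> x"
  using pair_no_loops by fastforce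

lemma adj_verts: "x \<sim> y \<Longrightarrow> x \<in> V" "x \<sim> y \<Longrightarrow> y \<in> V"
  by (rule in_arcsD1, assumption) (rule in_arcsD2)

lemma relpow_d: "u \<in> V \<Longrightarrow> v \<in> V \<Longrightarrow> (u, v) \<in> parcs G ^^ d u v"
  using reach[of u v] gdist_eq_Least[of u v] rtrancl_imp_relpow[of "(u, v)" "parcs G"]
  by (metis LeastI_ex)

lemma d_le_relpow:
  assumes "u \<in> V" "(u, v) \<in> parcs G ^^ n" shows "d u v \<le> n"
  using gdist_eq_Least[OF assms(1) relpow_imp_rtrancl, OF assms(2)] assms(2)
  by (simp add: Least_le)

lemma relpow_converse: "(u, v) \<in> parcs G ^^ n \<Longrightarrow> (v, u) \<in> parcs G ^^ n"
proof (induction n arbitrary: u)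
  case (Suc n)
  then show ?case by (metis adj_sym relpow_Suc_D2 relpow_Suc_I)
qed auto

lemma d_sym: "u \<in> V \<Longrightarrow> v \<in> V \<Longrightarrow> d u v = d v u"
  by (metis antisym d_le_relpow relpow_converse relpow_d)

lemma d_self [simp]: "u \<in> V \<Longrightarrow> d u u = 0"
  using d_le_relpow[of u u 0] by simp

lemma d_eq_0_iff: "u \<in> V \<Longrightarrow> v \<in> V \<Longrightarrow> d u v = 0 \<longleftrightarrow> u = v"
  using relpow_d[of u v] by auto

lemma d_eq_1_iff: "u \<in> V \<Longrightarrow> v \<in> V \<Longrightarrow> d u v = 1 \<longleftrightarrow> u \<sim> v"
  using relpow_d[of u v] d_le_relpow[of u v 1] d_eq_0_iff[of u v] by (auto simp: le_Suc_eq)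

lemma d_adj: "x \<sim> y \<Longrightarrow> d x y = 1"
  using d_eq_1_iff adj_verts by blast

lemma d_triangle:
  assumes "x \<in> V" "y \<in> V" "z \<in> V" shows "d x z \<le> d x y + d y z"
proof -
  have "(x, z) \<in> parcs G ^^ d x y O parcs G ^^ d y z"
    using relpow_d assms by blast
  then show ?thesis using d_le_relpow assms(1) by (metis relpow_add)
qed

lemma d_adj_le: "u \<in> V \<Longrightarrow> x \<sim> y \<Longrightarrow> d u y \<le> d u x + 1 \<and> d u x \<le> d u y + 1"
  using d_triangle[of u x y] d_triangle[of u y x] d_adj[of x y] d_adj[of y x]
    adj_sym[of x y] adj_verts[of x y] by simp

lemma d_eq_2I: "x \<noteq> y \<Longrightarrow> \<not> x \<sim> y \<Longrightarrow> x \<sim> z \<Longrightarrow> z \<sim> y \<Longrightarrow> d x y = 2"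
  using d_triangle[of x z y] d_adj[of x z] d_adj[of z y] d_eq_0_iff[of x y] d_eq_1_iff[of x y]
    adj_verts[of x z] adj_verts[of z y] by force

lemma closer_neighbour:
  assumes "u \<in> V" "v \<in> V" "u \<noteq> v"
  obtains w where "w \<sim> v" "d u w + 1 = d u v"
proof -
  obtain n where n: "d u v = Suc n" using assms d_eq_0_iff not0_implies_Suc by blast
  then obtain w where w: "(u, w) \<in> parcs G ^^ n" "w \<sim> v"
    using relpow_d[of u v] assms by auto
  then have "d u w \<le> n" using d_le_relpow assms(1) by blast
  then have "d u w + 1 = d u v" using d_adj_le[of u w v] w n assms by simp
  with w that show thesis by blast
qed

lemma d_eq_2E:
  assumes "x \<in> V" "y \<in> V" "d x y = 2"
  obtains z where "x \<sim> z" "z \<sim> y" "x \<noteq> y" "\<not> x \<sim> y"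
proof -
  have ne: "x \<noteq> y" "\<not> x \<sim> y" using assms d_eq_1_iff[of x y] by auto
  then obtain z where "z \<sim> y" "d x z + 1 = d x y" using closer_neighbour assms by blast
  then have "z \<sim> y" "x \<sim> z" using d_eq_1_iff[of x z] adj_verts[of z y] assms by auto
  with that ne show thesis by blast
qed

lemma d_eq_2_iff:
  "x \<in> V \<Longrightarrow> y \<in> V \<Longrightarrow> d x y = 2 \<longleftrightarrow> x \<noteq> y \<and> \<not> x \<sim> y \<and> (\<exists>z. x \<sim> z \<and> z \<sim> y)"
  by (meson d_eq_2E d_eq_2I)

lemma mem_I: "x \<in> I u v \<longleftrightarrow> x \<in> V \<and> d u x + d x v = d u v"
  by (simp add: interval_def)

lemma I_sym: "u \<in> V \<Longrightarrow> v \<in> V \<Longrightarrow> I u v = I v u"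
  by (auto simp: mem_I d_sym)

lemma I_trans:
  assumes "u \<in> V" "v \<in> V" "y \<in> I u v" shows "I u y \<subseteq> I u v"
proof
  fix z assume z: "z \<in> I u y"
  have "d u z + d z y = d u y" "d u y + d y v = d u v" using z assms by (auto simp: mem_I)
  moreover have "d z v \<le> d z y + d y v" "d u v \<le> d u z + d z v"
    using z assms by (auto simp: mem_I intro: d_triangle)
  ultimately show "z \<in> I u v" using z by (simp add: mem_I)
qed

lemma common_neighbour_mem_I:
  assumes "x \<sim> z" "z \<sim> y" "x \<noteq> y" "\<not> x \<sim> y" shows "z \<in> I x y"
  using d_eq_2I[of x y z] d_adj[of x z] d_adj[of z y] adj_verts[of x z] assms by (simp add: mem_I)

lemma geod_convexD: "geod_convex G A \<Longrightarrow> x \<in> A \<Longrightarrow> y \<in> A \<Longrightarrow> z \<in> I x y \<Longrightarrow> z \<in> A"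
  unfolding geod_convex_def by blast

lemma geod_convex_common_neighbour:
  "geod_convex G A \<Longrightarrow> x \<in> A \<Longrightarrow> y \<in> A \<Longrightarrow> x \<noteq> y \<Longrightarrow> \<not> x \<sim> y \<Longrightarrow> x \<sim> z \<Longrightarrow> z \<sim> y \<Longrightarrow> z \<in> A"
  using geod_convexD common_neighbour_mem_I by blast

end

lemma connected_simple_graph_imp_connected_graph:
  assumes "connected_simple_graph G" shows "connected_graph G"
proof -
  interpret pair_bidirected_digraph G using assms unfolding connected_simple_graph_def by blast
  have arcs: "parcs (mk_symmetric (with_proj G)) = parcs G"
    unfolding mk_symmetric_def using arcs_symmetric by auto
  have "(u, v) \<in> (parcs G)\<^sup>*" if "u \<in> pverts G" "v \<in> pverts G" for u v
  proof -
    have "reachable (with_proj (mk_symmetric (with_proj G))) u v"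
      using assms that unfolding connected_simple_graph_def connected_def strongly_connected_def
      by (auto simp: mk_symmetric_def)
    then show ?thesis
      unfolding reachable_def using arcs by (metis rtrancl_on_rtranclI with_proj_simps(3))
  qed
  then show ?thesis by unfold_locales
qed

section \<open>Isometric copies of the forbidden graphs\<close>

text \<open>A copy of \<open>H\<close> is isometric if it is induced and distances agree for those pairs that have
  no common neighbour in \<open>H\<close>; the other distances are at most two and are read off from the edges.\<close>

lemma contains_isometricI:
  assumes "connected_graph G" "connected_graph H"
    and f: "inj_on f (pverts H)" "f ` pverts H \<subseteq> pverts G"
    and induced: "\<And>x y. x \<in> pverts H \<Longrightarrow> y \<in> pverts H \<Longrightarrow> (f x, f y) \<in> parcs G \<longleftrightarrow> (x, y) \<in> parcs H"
    and far: "\<And>x y. x \<in> pverts H \<Longrightarrow> y \<in> pverts H \<Longrightarrow> x \<noteq> y \<Longrightarrow> (x, y) \<notin> parcs H \<Longrightarrow>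
      \<nexists>z. (x, z) \<in> parcs H \<and> (z, y) \<in> parcs H \<Longrightarrow> gdist G (f x) (f y) = gdist H x y"
  shows "contains_isometric G H"
proof -
  interpret G: connected_graph G by fact
  interpret H: connected_graph H by fact
  have "G.d (f x) (f y) = H.d x y" if xy: "x \<in> pverts H" "y \<in> pverts H" for x y
  proof -
    have fxy: "f x \<in> pverts G" "f y \<in> pverts G" using xy f(2) by auto
    consider "x = y" | "H.adj x y"
      | z where "H.adj x z" "H.adj z y" "x \<noteq> y" "\<not> H.adj x y"
      | "x \<noteq> y" "\<not> H.adj x y" "\<nexists>z. H.adj x z \<and> H.adj z y"
      by blast
    then show ?thesis
    proof cases
      case 3
      have "z \<in> pverts H" using 3 H.adj_verts by blast
      then have "G.d (f x) (f y) = 2"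
        using 3 induced xy f(1) by (intro G.d_eq_2I[of _ _ "f z"]) (auto dest: inj_onD)
      then show ?thesis using H.d_eq_2I[OF 3(3,4,1,2)] by simp
    qed (use xy fxy induced far G.d_adj H.d_adj in auto)
  qed
  then show ?thesis unfolding contains_isometric_def using f(2) by blast
qed

lemma contains_isometricE:
  assumes "connected_graph G" "connected_graph H" "contains_isometric G H"
  obtains f where "f ` pverts H \<subseteq> pverts G" "inj_on f (pverts H)"
    "\<And>x y. x \<in> pverts H \<Longrightarrow> y \<in> pverts H \<Longrightarrow> (f x, f y) \<in> parcs G \<longleftrightarrow> (x, y) \<in> parcs H"
    "\<And>x y. x \<in> pverts H \<Longrightarrow> y \<in> pverts H \<Longrightarrow> gdist G (f x) (f y) = gdist H x y"
proof -
  interpret G: connected_graph G by fact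
  interpret H: connected_graph H by fact
  obtain f where f: "f ` pverts H \<subseteq> pverts G"
    and iso: "\<And>x y. x \<in> pverts H \<Longrightarrow> y \<in> pverts H \<Longrightarrow> gdist G (f x) (f y) = gdist H x y"
    using assms(3) unfolding contains_isometric_def by blast
  have "inj_on f (pverts H)"
    by (rule inj_onI) (metis f image_subset_iff iso G.d_self H.d_eq_0_iff)
  moreover have "(f x, f y) \<in> parcs G \<longleftrightarrow> (x, y) \<in> parcs H"
    if "x \<in> pverts H" "y \<in> pverts H" for x y
    using that f iso[OF that] G.d_eq_1_iff[of "f x" "f y"] H.d_eq_1_iff[of x y] by auto
  ultimately show thesis using that f iso by blast
qed

lemma connected_graph_graph_of_edges:
  assumes "\<And>x. (x, x) \<notin> r" and "\<And>x y. x \<in> Field r \<Longrightarrow> y \<in> Field r \<Longrightarrow> (x, y) \<in> (r \<union> r\<inverse>)\<^sup>*"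
  shows "connected_graph (graph_of_edges r)"
proof unfold_locales
  let ?G = "graph_of_edges r"
  show "fst e \<in> pverts ?G" "snd e \<in> pverts ?G" if "e \<in> parcs ?G" for e
    using that by (cases e; force simp: graph_of_edges_def Field_def)+
  show "symmetric (with_proj ?G)"
    by (simp add: symmetric_def graph_of_edges_def sym_Un_converse)
  show "fst e \<noteq> snd e" if "e \<in> parcs ?G" for e
    using that assms(1) by (cases e) (auto simp: graph_of_edges_def)
  show "(u, v) \<in> (parcs ?G)\<^sup>*" if "u \<in> pverts ?G" "v \<in> pverts ?G" for u v
    using that assms(2) by (simp add: graph_of_edges_def)
qed

lemma connected_graph_graph_of_edges_root:
  assumes "\<And>x. (x, x) \<notin> r" and root: "\<And>x. x \<in> Field r \<Longrightarrow> (c, x) \<in> (r \<union> r\<inverse>)\<^sup>*"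
  shows "connected_graph (graph_of_edges r)"
proof (rule connected_graph_graph_of_edges)
  have "sym ((r \<union> r\<inverse>)\<^sup>*)" by (intro sym_rtrancl sym_Un_converse)
  then show "(x, y) \<in> (r \<union> r\<inverse>)\<^sup>*" if "x \<in> Field r" "y \<in> Field r" for x y
    using root[OF that(1)] root[OF that(2)] by (meson rtrancl_trans symD)
qed (use assms in blast)

lemma all_label: "(\<forall>l::label. P l) \<longleftrightarrow> P LU \<and> P LV \<and> P LX \<and> P LY \<and> P LW \<and> P LA \<and> P LB"
  by (metis label.exhaust)

lemma ex_label: "(\<exists>l::label. P l) \<longleftrightarrow> P LU \<or> P LV \<or> P LX \<or> P LY \<or> P LW \<or> P LA \<or> P LB"
  by (metis label.exhaust)

lemma pverts_forbidden [simp]: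
  "pverts W4_minus = {LU, LV, LX, LY, LW}"
  "pverts K23 = {LU, LV, LX, LY, LW}"
  "pverts K23_plus = {LU, LV, LX, LY, LW}"
  "pverts R1 = {LU, LV, LX, LY, LW, LA, LB}"
  by (auto simp: W4_minus_def K23_def K23_plus_def R1_def graph_of_edges_def Field_def)

text \<open>All four forbidden graphs have a vertex from which every other vertex is at most two steps away.\<close>

lemma connected_graph_graph_of_edges_steps:
  assumes "\<And>x. (x, x) \<notin> r"
    and near: "\<And>x. x \<in> Field r \<Longrightarrow> x = c \<or> (c, x) \<in> r \<union> r\<inverse> \<or>
      (\<exists>y. (c, y) \<in> r \<union> r\<inverse> \<and> (y, x) \<in> r \<union> r\<inverse>)"
  shows "connected_graph (graph_of_edges r)"
proof (rule connected_graph_graph_of_edges_root)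
  show "(c, x) \<in> (r \<union> r\<inverse>)\<^sup>*" if "x \<in> Field r" for x
    using near[OF that] by (meson converse_rtrancl_into_rtrancl rtrancl.rtrancl_refl)
qed fact

lemma connected_forbidden:
  shows connected_W4_minus: "connected_graph W4_minus"
    and connected_K23: "connected_graph K23"
    and connected_K23_plus: "connected_graph K23_plus"
    and connected_R1: "connected_graph R1"
proof -
  show "connected_graph W4_minus" unfolding W4_minus_def
    by (rule connected_graph_graph_of_edges_steps[where c = LU])
       (use label.exhaust in \<open>auto simp: Field_def ex_label\<close>)
  show "connected_graph K23" unfolding K23_def
    by (rule connected_graph_graph_of_edges_steps[where c = LU])
       (use label.exhaust in \<open>auto simp: Field_def ex_label\<close>)
  show "connected_graph K23_plus" unfolding K23_plus_def
    by (rule connected_graph_graph_of_edges_steps[where c = LU])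
       (use label.exhaust in \<open>auto simp: Field_def ex_label\<close>)
  show "connected_graph R1" unfolding R1_def
    by (rule connected_graph_graph_of_edges_steps[where c = LA])
       (use label.exhaust in \<open>auto simp: Field_def ex_label\<close>)
qed

lemma parcs_graph_of_edges: "(a, b) \<in> parcs (graph_of_edges r) \<longleftrightarrow> (a, b) \<in> r \<or> (b, a) \<in> r"
  by (simp add: graph_of_edges_def)

lemmas parcs_forbidden =
  parcs_graph_of_edges[of _ _ "{(LU,LX), (LX,LW), (LW,LY), (LY,LU), (LU,LV), (LV,LX), (LV,LY)}",
    folded W4_minus_def]
  parcs_graph_of_edges[of _ _ "{LU, LV} \<times> {LX, LY, LW}", folded K23_def]
  parcs_graph_of_edges[of _ _ "insert (LU,LV) ({LU, LV} \<times> {LX, LY, LW})", folded K23_plus_def]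
  parcs_graph_of_edges[of _ _ "{(LU,LV), (LV,LX), (LX,LA), (LA,LY), (LY,LW), (LW,LB), (LB,LU),
    (LV,LB), (LB,LA), (LA,LW), (LW,LX), (LX,LB), (LV,LA)}", folded R1_def]

context connected_graph
begin

lemma contains_W4_minusI:
  assumes "x \<sim> u" "x \<sim> v" "x \<sim> w" "y \<sim> u" "y \<sim> v" "y \<sim> w" "u \<sim> v"
    and "x \<noteq> y" "\<not> x \<sim> y" "u \<noteq> w" "\<not> u \<sim> w" "v \<noteq> w" "\<not> v \<sim> w"
  shows "contains_isometric G W4_minus"
proof -
  define f where "f = (\<lambda>l. case l of LU \<Rightarrow> u | LV \<Rightarrow> v | LX \<Rightarrow> x | LY \<Rightarrow> y | _ \<Rightarrow> w)"
  have sym: "\<not> y \<sim> x" "\<not> w \<sim> u" "\<not> w \<sim> v" using assms adj_sym by blast+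
  note sym = sym assms(1-7)[THEN adj_sym]
  have ne: "x \<noteq> u" "x \<noteq> v" "x \<noteq> w" "y \<noteq> u" "y \<noteq> v" "y \<noteq> w" "u \<noteq> v"
    using assms by auto
  show ?thesis
  proof (rule contains_isometricI[of _ _ f, OF connected_graph_axioms connected_W4_minus])
    show "inj_on f (pverts W4_minus)" using assms ne ne[symmetric] by (auto simp: f_def)
    show "f ` pverts W4_minus \<subseteq> V" using assms adj_verts by (auto simp: f_def)
    have "\<forall>a\<in>pverts W4_minus. \<forall>b\<in>pverts W4_minus. f a \<sim> f b \<longleftrightarrow> (a, b) \<in> parcs W4_minus"
      using assms sym by (simp add: f_def parcs_forbidden)
    then show "f a \<sim> f b \<longleftrightarrow> (a, b) \<in> parcs W4_minus"
      if "a \<in> pverts W4_minus" "b \<in> pverts W4_minus" for a b using that by blast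
    have "\<forall>a\<in>pverts W4_minus. \<forall>b\<in>pverts W4_minus. a = b \<or> (a, b) \<in> parcs W4_minus \<or>
        (\<exists>c. (a, c) \<in> parcs W4_minus \<and> (c, b) \<in> parcs W4_minus)"
      by (simp add: parcs_forbidden ex_label)
    then show "d (f a) (f b) = gdist W4_minus a b" if "a \<in> pverts W4_minus" "b \<in> pverts W4_minus"
      "a \<noteq> b" "(a, b) \<notin> parcs W4_minus"
      "\<nexists>c. (a, c) \<in> parcs W4_minus \<and> (c, b) \<in> parcs W4_minus" for a b
      using that by blast
  qed
qed

lemma contains_K23I:
  assumes "u \<sim> x" "u \<sim> y" "u \<sim> w" "v \<sim> x" "v \<sim> y" "v \<sim> w"
    and "u \<noteq> v" "\<not> u \<sim> v" "x \<noteq> y" "\<not> x \<sim> y" "x \<noteq> w" "\<not> x \<sim> w" "y \<noteq> w" "\<not> y \<sim> w"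
  shows "contains_isometric G K23"
proof -
  define f where "f = (\<lambda>l. case l of LU \<Rightarrow> u | LV \<Rightarrow> v | LX \<Rightarrow> x | LY \<Rightarrow> y | _ \<Rightarrow> w)"
  have sym: "\<not> v \<sim> u" "\<not> y \<sim> x" "\<not> w \<sim> x" "\<not> w \<sim> y" using assms adj_sym by blast+
  note sym = sym assms(1-6)[THEN adj_sym]
  have ne: "u \<noteq> x" "u \<noteq> y" "u \<noteq> w" "v \<noteq> x" "v \<noteq> y" "v \<noteq> w" using assms by auto
  show ?thesis
  proof (rule contains_isometricI[of _ _ f, OF connected_graph_axioms connected_K23])
    show "inj_on f (pverts K23)" using assms ne ne[symmetric] by (auto simp: f_def)
    show "f ` pverts K23 \<subseteq> V" using assms adj_verts by (auto simp: f_def)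
    have "\<forall>a\<in>pverts K23. \<forall>b\<in>pverts K23. f a \<sim> f b \<longleftrightarrow> (a, b) \<in> parcs K23"
      using assms sym by (simp add: f_def parcs_forbidden)
    then show "f a \<sim> f b \<longleftrightarrow> (a, b) \<in> parcs K23"
      if "a \<in> pverts K23" "b \<in> pverts K23" for a b using that by blast
    have "\<forall>a\<in>pverts K23. \<forall>b\<in>pverts K23. a = b \<or> (a, b) \<in> parcs K23 \<or>
        (\<exists>c. (a, c) \<in> parcs K23 \<and> (c, b) \<in> parcs K23)"
      by (simp add: parcs_forbidden ex_label)
    then show "d (f a) (f b) = gdist K23 a b" if "a \<in> pverts K23" "b \<in> pverts K23"
      "a \<noteq> b" "(a, b) \<notin> parcs K23" "\<nexists>c. (a, c) \<in> parcs K23 \<and> (c, b) \<in> parcs K23" for a b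
      using that by blast
  qed
qed

lemma contains_K23_plusI:
  assumes "u \<sim> x" "u \<sim> y" "u \<sim> w" "v \<sim> x" "v \<sim> y" "v \<sim> w" "u \<sim> v"
    and "x \<noteq> y" "\<not> x \<sim> y" "x \<noteq> w" "\<not> x \<sim> w" "y \<noteq> w" "\<not> y \<sim> w"
  shows "contains_isometric G K23_plus"
proof -
  define f where "f = (\<lambda>l. case l of LU \<Rightarrow> u | LV \<Rightarrow> v | LX \<Rightarrow> x | LY \<Rightarrow> y | _ \<Rightarrow> w)"
  have sym: "\<not> y \<sim> x" "\<not> w \<sim> x" "\<not> w \<sim> y" using assms adj_sym by blast+
  note sym = sym assms(1-7)[THEN adj_sym]
  have ne: "u \<noteq> x" "u \<noteq> y" "u \<noteq> w" "v \<noteq> x" "v \<noteq> y" "v \<noteq> w" "u \<noteq> v" using assms by auto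
  show ?thesis
  proof (rule contains_isometricI[of _ _ f, OF connected_graph_axioms connected_K23_plus])
    show "inj_on f (pverts K23_plus)" using assms ne ne[symmetric] by (auto simp: f_def)
    show "f ` pverts K23_plus \<subseteq> V" using assms adj_verts by (auto simp: f_def)
    have "\<forall>a\<in>pverts K23_plus. \<forall>b\<in>pverts K23_plus. f a \<sim> f b \<longleftrightarrow> (a, b) \<in> parcs K23_plus"
      using assms sym by (simp add: f_def parcs_forbidden)
    then show "f a \<sim> f b \<longleftrightarrow> (a, b) \<in> parcs K23_plus"
      if "a \<in> pverts K23_plus" "b \<in> pverts K23_plus" for a b using that by blast
    have "\<forall>a\<in>pverts K23_plus. \<forall>b\<in>pverts K23_plus. a = b \<or> (a, b) \<in> parcs K23_plus \<or>
        (\<exists>c. (a, c) \<in> parcs K23_plus \<and> (c, b) \<in> parcs K23_plus)"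
      by (simp add: parcs_forbidden ex_label)
    then show "d (f a) (f b) = gdist K23_plus a b" if "a \<in> pverts K23_plus" "b \<in> pverts K23_plus"
      "a \<noteq> b" "(a, b) \<notin> parcs K23_plus"
      "\<nexists>c. (a, c) \<in> parcs K23_plus \<and> (c, b) \<in> parcs K23_plus" for a b
      using that by blast
  qed
qed

lemma d_eq_3I:
  assumes "u \<sim> a" "a \<sim> b" "b \<sim> v" and "u \<noteq> v" "\<not> u \<sim> v" "\<nexists>c. u \<sim> c \<and> c \<sim> v"
  shows "d u v = 3"
proof -
  have uv: "u \<in> V" "v \<in> V" using assms adj_verts by blast+
  have "d u v \<le> 3"
    using d_adj_le[OF uv(1) assms(3)] d_adj_le[OF uv(1) assms(2)] d_adj[OF assms(1)] by simp
  moreover have "d u v \<noteq> 0" "d u v \<noteq> 1" "d u v \<noteq> 2"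
    using assms(4-6) d_eq_0_iff[OF uv] d_eq_1_iff[OF uv] d_eq_2_iff[OF uv] by auto
  ultimately show ?thesis by linarith
qed

text \<open>The graph \<open>R_1\<close> is a \<open>K_5\<close> without the edge \<open>vw\<close>, on the vertices \<open>v x a b w\<close>, with a triangle
  on \<open>vb\<close> and a triangle on \<open>aw\<close> attached to it; the two added vertices \<open>u\<close> and \<open>y\<close> are its only
  pair at distance three.\<close>

lemma contains_R1I:
  assumes uy: "d u y = 3"
    and "u \<sim> v" "u \<sim> b" "y \<sim> a" "y \<sim> w"
    and "v \<sim> x" "v \<sim> a" "v \<sim> b" "w \<sim> x" "w \<sim> a" "w \<sim> b" "x \<sim> a" "x \<sim> b" "a \<sim> b"
    and "v \<noteq> w" "\<not> v \<sim> w" "u \<noteq> x" "\<not> u \<sim> x" "y \<noteq> x" "\<not> y \<sim> x"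
  shows "contains_isometric G R1"
proof -
  define f where "f = (\<lambda>l. case l of LU \<Rightarrow> u | LV \<Rightarrow> v | LX \<Rightarrow> x | LY \<Rightarrow> y | LW \<Rightarrow> w | LA \<Rightarrow> a | LB \<Rightarrow> b)"
  have uyV: "u \<in> V" "y \<in> V" using assms adj_verts by blast+
  have far: "\<not> u \<sim> z \<or> \<not> y \<sim> z" for z
    using uy d_triangle[of u z y] d_adj[of u z] d_adj[of z y] adj_sym[of y z] adj_verts[of u z] uyV
    by auto
  have "\<not> u \<sim> a" "\<not> u \<sim> w" "\<not> y \<sim> v" "\<not> y \<sim> b" using far assms by blast+
  moreover have "u \<noteq> y" "\<not> u \<sim> y" using uy uyV d_adj by force+
  ultimately have non: "\<not> u \<sim> a" "\<not> u \<sim> w" "\<not> y \<sim> v" "\<not> y \<sim> b" "u \<noteq> y" "\<not> u \<sim> y" by blast+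
  have ne: "u \<noteq> v" "u \<noteq> b" "y \<noteq> a" "y \<noteq> w" "v \<noteq> x" "v \<noteq> a" "v \<noteq> b" "w \<noteq> x" "w \<noteq> a" "w \<noteq> b"
    "x \<noteq> a" "x \<noteq> b" "a \<noteq> b" "u \<noteq> a" "u \<noteq> w" "y \<noteq> v" "y \<noteq> b"
    using assms non adj_sym by auto
  have sym: "\<not> w \<sim> v" "\<not> x \<sim> u" "\<not> x \<sim> y" "\<not> a \<sim> u" "\<not> w \<sim> u" "\<not> v \<sim> y" "\<not> b \<sim> y" "\<not> y \<sim> u"
    using assms non adj_sym by blast+
  note sym = sym assms(2-14)[THEN adj_sym]
  interpret R: connected_graph R1 by (rule connected_R1)
  have "R.d LU LY = 3" "R.d LY LU = 3"
    by (rule R.d_eq_3I[of _ LB LA] R.d_eq_3I[of _ LA LB]; simp add: parcs_forbidden ex_label)+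
  then have R: "R.d LU LY = d u y" "R.d LY LU = d y u"
    using uy uyV d_sym by auto
  show ?thesis
  proof (rule contains_isometricI[of _ _ f, OF connected_graph_axioms connected_R1])
    show "inj_on f (pverts R1)" using assms non ne ne[symmetric] by (auto simp: f_def)
    show "f ` pverts R1 \<subseteq> V" using assms adj_verts by (auto simp: f_def)
    have "\<forall>p q. f p \<sim> f q \<longleftrightarrow> (p, q) \<in> parcs R1"
      unfolding all_label f_def using assms(2-) non sym by (simp add: parcs_forbidden)
    then show "f p \<sim> f q \<longleftrightarrow> (p, q) \<in> parcs R1" for p q by blast
    show "d (f p) (f q) = R.d p q" if "p \<in> pverts R1" "q \<in> pverts R1"
      "p \<noteq> q" "(p, q) \<notin> parcs R1" "\<nexists>c. (p, c) \<in> parcs R1 \<and> (c, q) \<in> parcs R1" for p q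
    proof -
      have "\<forall>p q. p = q \<or> (p, q) \<in> parcs R1 \<or> (\<exists>c. (p, c) \<in> parcs R1 \<and> (c, q) \<in> parcs R1) \<or>
          p = LU \<and> q = LY \<or> p = LY \<and> q = LU"
        unfolding all_label by (simp add: parcs_forbidden ex_label)
      then have "p = LU \<and> q = LY \<or> p = LY \<and> q = LU" using that by blast
      then show ?thesis using R by (auto simp: f_def)
    qed
  qed
qed

end

section \<open>Necessity of the forbidden subgraphs\<close>

context connected_graph
begin

lemma mem_conv_iff: "x \<in> conv G S \<longleftrightarrow> (\<forall>A. geod_convex G A \<and> S \<subseteq> A \<longrightarrow> x \<in> A)"
  unfolding conv_def hull_def by blast

lemma conv_I: "x \<in> conv G S \<Longrightarrow> y \<in> conv G S \<Longrightarrow> z \<in> I x y \<Longrightarrow> z \<in> conv G S"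
  unfolding mem_conv_iff using geod_convexD by blast

lemma conv_common_neighbour:
  "x \<in> conv G S \<Longrightarrow> y \<in> conv G S \<Longrightarrow> x \<noteq> y \<Longrightarrow> \<not> x \<sim> y \<Longrightarrow> x \<sim> z \<Longrightarrow> z \<sim> y \<Longrightarrow> z \<in> conv G S"
  using conv_I common_neighbour_mem_I by blast

lemma conv_base: "x \<in> S \<Longrightarrow> x \<in> conv G S"
  unfolding mem_conv_iff by blast

lemma mem_shadow: "x \<in> shadow G v u \<longleftrightarrow> x \<in> V \<and> v \<in> conv G {u, x}"
  by (simp add: shadow_def)

lemma I_self: "x \<in> V \<Longrightarrow> I x x = {x}"
  by (auto simp: mem_I d_eq_0_iff)

lemma I_adj: "x \<sim> y \<Longrightarrow> I x y = {x, y}"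
  using adj_verts[of x y] d_adj[of x y] by (auto simp: mem_I add_is_1 d_eq_0_iff)

lemma endpoint_mem_I: "u \<in> V \<Longrightarrow> v \<in> V \<Longrightarrow> u \<in> I u v" "u \<in> V \<Longrightarrow> v \<in> V \<Longrightarrow> v \<in> I u v"
  by (simp_all add: mem_I)

lemma I_two:
  assumes "x \<in> V" "y \<in> V" "d x y = 2"
  shows "I x y = {x, y} \<union> {z. x \<sim> z \<and> z \<sim> y}"
proof
  show "I x y \<subseteq> {x, y} \<union> {z. x \<sim> z \<and> z \<sim> y}"
  proof
    fix z assume "z \<in> I x y"
    then have z: "z \<in> V" "d x z + d z y = 2" using assms by (auto simp: mem_I)
    then consider "d x z = 0" | "d x z = 1" "d z y = 1" | "d z y = 0" by linarith
    then show "z \<in> {x, y} \<union> {z. x \<sim> z \<and> z \<sim> y}"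
      using z assms d_eq_0_iff d_eq_1_iff by cases auto
  qed
  show "{x, y} \<union> {z. x \<sim> z \<and> z \<sim> y} \<subseteq> I x y"
    using assms common_neighbour_mem_I d_eq_2_iff[of x y] by (auto simp: mem_I)
qed

lemma edge_convex: "x \<sim> y \<Longrightarrow> geod_convex G {x, y}"
  using adj_verts[of x y] I_adj[of x y] I_adj[of y x] adj_sym[of x y]
  by (auto simp: geod_convex_def I_self)

lemma conv_edge: "x \<sim> y \<Longrightarrow> z \<in> conv G {x, y} \<Longrightarrow> z = x \<or> z = y"
  using edge_convex unfolding mem_conv_iff by blast

lemma shadow_convexD:
  assumes "strongly_smooth G" "u \<in> V" "v \<in> V" "x \<in> shadow G v u" "y \<in> shadow G v u"
    "x \<noteq> y" "\<not> x \<sim> y" "x \<sim> z" "z \<sim> y"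
  shows "v \<in> conv G {u, z}"
proof -
  have "geod_convex G (shadow G v u)" using assms unfolding strongly_smooth_def by blast
  from geod_convex_common_neighbour[OF this assms(4-9)] show ?thesis by (simp add: mem_shadow)
qed

text \<open>In \<open>K_{2,3}\<close> the shadow \<open>w/x\<close> contains \<open>w\<close> and \<open>y\<close>, because the hull of \<open>x\<close> and \<open>y\<close> contains \<open>u\<close>
  and \<open>v\<close>, but it does not contain \<open>u\<close>, which is adjacent to \<open>x\<close>.\<close>

lemma strongly_smooth_no_K23:
  assumes "strongly_smooth G" shows "\<not> contains_isometric G K23"
proof
  assume "contains_isometric G K23"
  then obtain f where f: "f ` pverts K23 \<subseteq> V" "inj_on f (pverts K23)"
    and e: "\<And>x y. x \<in> pverts K23 \<Longrightarrow> y \<in> pverts K23 \<Longrightarrow> f x \<sim> f y \<longleftrightarrow> (x, y) \<in> parcs K23"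
    by (rule contains_isometricE[OF connected_graph_axioms connected_K23]) blast
  define u v x y w where "u = f LU" "v = f LV" "x = f LX" "y = f LY" "w = f LW"
  note defs = this
  have V: "u \<in> V" "v \<in> V" "x \<in> V" "y \<in> V" "w \<in> V" and ne: "u \<noteq> v" "x \<noteq> y" "y \<noteq> w" "w \<noteq> u" "w \<noteq> x"
    using f unfolding defs by (auto simp: inj_on_def)
  have adj: "x \<sim> u" "x \<sim> v" "u \<sim> y" "v \<sim> y" "u \<sim> w" "w \<sim> v" "y \<sim> u"
    and non: "\<not> u \<sim> v" "\<not> x \<sim> y" "\<not> y \<sim> w"
    unfolding defs by (auto simp: e) (auto simp: parcs_forbidden)
  have "u \<in> conv G {x, y}" "v \<in> conv G {x, y}"
    using conv_common_neighbour[of x "{x, y}" y] conv_base ne adj non by auto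
  then have "w \<in> conv G {x, y}" using conv_common_neighbour[of u "{x, y}" v w] ne adj non by blast
  then have "y \<in> shadow G w x" "w \<in> shadow G w x" using V by (auto simp: mem_shadow conv_base)
  then have "w \<in> conv G {x, u}" using shadow_convexD[OF assms, of x w y w u] V ne adj non by blast
  then show False using conv_edge adj(1) ne by blast
qed

text \<open>In \<open>W_4\<^sup>-\<close> the shadow \<open>v/u\<close> contains \<open>v\<close> and \<open>w\<close>, because the hull of \<open>u\<close> and \<open>w\<close> contains \<open>x\<close>
  and \<open>y\<close>, but it does not contain \<open>x\<close>.\<close>

lemma strongly_smooth_no_W4_minus:
  assumes "strongly_smooth G" shows "\<not> contains_isometric G W4_minus"
proof
  assume "contains_isometric G W4_minus"
  then obtain f where f: "f ` pverts W4_minus \<subseteq> V" "inj_on f (pverts W4_minus)"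
    and e: "\<And>x y. x \<in> pverts W4_minus \<Longrightarrow> y \<in> pverts W4_minus \<Longrightarrow> f x \<sim> f y \<longleftrightarrow> (x, y) \<in> parcs W4_minus"
    by (rule contains_isometricE[OF connected_graph_axioms connected_W4_minus]) blast
  define u v x y w where "u = f LU" "v = f LV" "x = f LX" "y = f LY" "w = f LW"
  note defs = this
  have V: "u \<in> V" "v \<in> V" "x \<in> V" "y \<in> V" "w \<in> V" and ne: "u \<noteq> w" "x \<noteq> y" "v \<noteq> w" "v \<noteq> u" "v \<noteq> x"
    using f unfolding defs by (auto simp: inj_on_def)
  have adj: "u \<sim> x" "x \<sim> w" "u \<sim> y" "y \<sim> w" "x \<sim> v" "v \<sim> y" "v \<sim> x"
    and non: "\<not> u \<sim> w" "\<not> x \<sim> y" "\<not> v \<sim> w"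
    unfolding defs by (auto simp: e) (auto simp: parcs_forbidden)
  have "x \<in> conv G {u, w}" "y \<in> conv G {u, w}"
    using conv_common_neighbour[of u "{u, w}" w] conv_base ne adj non by auto
  then have "v \<in> conv G {u, w}" using conv_common_neighbour[of x "{u, w}" y v] ne adj non by blast
  then have "w \<in> shadow G v u" "v \<in> shadow G v u" using V by (auto simp: mem_shadow conv_base)
  then have "v \<in> conv G {u, x}" using shadow_convexD[OF assms, of u v v w x] V ne adj non by blast
  then show False using conv_edge adj(1) ne by blast
qed

text \<open>In the propeller, the shadow \<open>v/x\<close> of one end of the central edge \<open>uv\<close> contains the other two
  blades \<open>y\<close> and \<open>w\<close>, but not \<open>u\<close>.\<close>

lemma strongly_smooth_no_K23_plus:
  assumes "strongly_smooth G" shows "\<not> contains_isometric G K23_plus"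
proof
  assume "contains_isometric G K23_plus"
  then obtain f where f: "f ` pverts K23_plus \<subseteq> V" "inj_on f (pverts K23_plus)"
    and e: "\<And>x y. x \<in> pverts K23_plus \<Longrightarrow> y \<in> pverts K23_plus \<Longrightarrow> f x \<sim> f y \<longleftrightarrow> (x, y) \<in> parcs K23_plus"
    by (rule contains_isometricE[OF connected_graph_axioms connected_K23_plus]) blast
  define u v x y w where "u = f LU" "v = f LV" "x = f LX" "y = f LY" "w = f LW"
  note defs = this
  have V: "u \<in> V" "v \<in> V" "x \<in> V" "y \<in> V" "w \<in> V" and ne: "x \<noteq> w" "x \<noteq> y" "y \<noteq> w" "v \<noteq> u" "v \<noteq> x"
    using f unfolding defs by (auto simp: inj_on_def)
  have adj: "x \<sim> u" "x \<sim> v" "v \<sim> y" "v \<sim> w" "y \<sim> u" "u \<sim> w"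
    and non: "\<not> x \<sim> w" "\<not> x \<sim> y" "\<not> y \<sim> w"
    unfolding defs by (auto simp: e) (auto simp: parcs_forbidden)
  have "v \<in> conv G {x, y}" "v \<in> conv G {x, w}"
    using conv_common_neighbour[of x "{x, y}" y v] conv_common_neighbour[of x "{x, w}" w v]
      conv_base ne adj non by auto
  then have "y \<in> shadow G v x" "w \<in> shadow G v x" using V by (auto simp: mem_shadow)
  then have "v \<in> conv G {x, u}" using shadow_convexD[OF assms, of x v y w u] V ne adj non by blast
  then show False using conv_edge adj(1) ne by blast
qed

end

locale W4_minus_K23_free_graph = connected_graph +
  assumes no_W4_minus: "\<not> contains_isometric G W4_minus"
    and no_K23: "\<not> contains_isometric G K23"
begin

text \<open>Three common neighbours of two nonadjacent vertices span a \<open>K_{2,3}\<close> with them if there is no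
  edge among the three, and a \<open>W_4\<^sup>-\<close> if there is exactly one. Hence there are always at least two
  edges; nearly every local argument below ends with this fact.\<close>

lemma nonadjacent_common_neighbours:
  assumes xy: "x \<noteq> y" "\<not> x \<sim> y"
    and pqr: "x \<sim> p" "y \<sim> p" "x \<sim> q" "y \<sim> q" "x \<sim> r" "y \<sim> r"
    and pq: "p \<noteq> q" "\<not> p \<sim> q" and r: "r \<noteq> p" "r \<noteq> q"
  shows "r \<sim> p" "r \<sim> q"
proof -
  have "r \<sim> p \<or> r \<sim> q"
    using contains_K23I[of x p q r y] no_K23 assms adj_sym by blast
  moreover have "r \<sim> q" if "r \<sim> p"
    using contains_W4_minusI[of x r p q y] no_W4_minus assms that by blast
  moreover have "r \<sim> p" if "r \<sim> q"
    using contains_W4_minusI[of x r q p y] no_W4_minus assms adj_sym that by blast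
  ultimately show "r \<sim> p" "r \<sim> q" by blast+
qed

text \<open>The common neighbours of \<open>x\<close> and \<open>y\<close> form a clique from which some pairwise disjoint edges are
  removed. If \<open>pq\<close> is one of the removed edges, then \<open>x\<close> and \<open>y\<close> are nonadjacent common neighbours
  of \<open>p\<close> and \<open>q\<close>, so every further common neighbour of \<open>p\<close> and \<open>q\<close> is adjacent to both \<open>x\<close> and \<open>y\<close>.\<close>

lemma interval_two_convex:
  assumes xy: "x \<in> V" "y \<in> V" "d x y = 2"
  shows "geod_convex G (I x y)"
  unfolding geod_convex_def
proof (intro conjI ballI)
  show "I x y \<subseteq> V" by (auto simp: mem_I)
  have ne: "x \<noteq> y" "\<not> x \<sim> y" using xy d_eq_2_iff by auto
  fix p q assume p: "p \<in> I x y" and q: "q \<in> I x y"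
  then have pqV: "p \<in> V" "q \<in> V" by (auto simp: mem_I)
  consider "p = q" | "p \<sim> q" | "p = x \<and> q = y \<or> p = y \<and> q = x"
    | "x \<sim> p" "p \<sim> y" "x \<sim> q" "q \<sim> y" "p \<noteq> q" "\<not> p \<sim> q"
    using p q I_two[OF xy] adj_sym by auto
  then show "I p q \<subseteq> I x y"
  proof cases
    case 4
    have "d p q = 2" using 4 adj_sym by (intro d_eq_2I[of _ _ x]) auto
    then have "I p q = {p, q} \<union> {z. p \<sim> z \<and> z \<sim> q}" using I_two pqV by blast
    moreover have "z \<in> I x y" if z: "p \<sim> z" "z \<sim> q" for z
    proof (cases "z = x \<or> z = y")
      case True
      then show ?thesis using xy by (auto simp: mem_I)
    next
      case False
      then have "z \<sim> x" "z \<sim> y"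
        using nonadjacent_common_neighbours[of p q x y z] 4 z ne adj_sym by blast+
      then show ?thesis using I_two[OF xy] adj_sym by blast
    qed
    ultimately show ?thesis using p q by auto
  qed (use p q pqV xy in \<open>auto simp: I_self I_adj I_sym\<close>)
qed

lemma conv_two:
  assumes "x \<in> V" "y \<in> V" "d x y = 2" shows "conv G {x, y} \<subseteq> I x y"
proof
  fix z assume "z \<in> conv G {x, y}"
  then show "z \<in> I x y"
    using interval_two_convex[OF assms] endpoint_mem_I[OF assms(1,2)] unfolding mem_conv_iff by blast
qed

end

context connected_graph
begin

text \<open>In \<open>R_1\<close> the shadow \<open>x/u\<close> contains \<open>x\<close> and \<open>y\<close>: the interval between \<open>u\<close> and \<open>y\<close> contains \<open>v\<close>
  and \<open>w\<close>, hence its hull contains \<open>x\<close>. It does not contain \<open>a\<close>, since the hull of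
  the vertices \<open>u\<close> and \<open>a\<close> at distance two consists of \<open>u\<close>, \<open>a\<close> and their common neighbours.\<close>

lemma strongly_smooth_no_R1:
  assumes "strongly_smooth G" shows "\<not> contains_isometric G R1"
proof
  assume "contains_isometric G R1"
  then obtain f where f: "f ` pverts R1 \<subseteq> V" "inj_on f (pverts R1)"
    and e: "\<And>x y. x \<in> pverts R1 \<Longrightarrow> y \<in> pverts R1 \<Longrightarrow> f x \<sim> f y \<longleftrightarrow> (x, y) \<in> parcs R1"
    and iso: "\<And>x y. x \<in> pverts R1 \<Longrightarrow> y \<in> pverts R1 \<Longrightarrow> d (f x) (f y) = gdist R1 x y"
    by (rule contains_isometricE[OF connected_graph_axioms connected_R1]) blast
  interpret W4_minus_K23_free_graph G
    using assms strongly_smooth_no_W4_minus strongly_smooth_no_K23 by unfold_locales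
  define u v x y w a b where
    "u = f LU" "v = f LV" "x = f LX" "y = f LY" "w = f LW" "a = f LA" "b = f LB"
  note defs = this
  have V: "u \<in> V" "v \<in> V" "x \<in> V" "y \<in> V" "w \<in> V" "a \<in> V" "b \<in> V"
    and ne: "u \<noteq> a" "v \<noteq> y" "v \<noteq> w" "x \<noteq> y" "x \<noteq> u" "x \<noteq> a" "u \<noteq> w"
    using f unfolding defs by (auto simp: inj_on_def)
  have adj: "u \<sim> b" "b \<sim> a" "u \<sim> v" "v \<sim> a" "a \<sim> y" "b \<sim> w" "w \<sim> y" "v \<sim> x" "x \<sim> w" "x \<sim> a"
    and non: "\<not> u \<sim> a" "\<not> v \<sim> y" "\<not> v \<sim> w" "\<not> x \<sim> y" "\<not> u \<sim> x" "\<not> u \<sim> w"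
    unfolding defs by (auto simp: e) (auto simp: parcs_forbidden)
  interpret R: connected_graph R1 by (rule connected_R1)
  have "R.d LU LY = 3"
    by (rule R.d_eq_3I[of _ LB LA]; simp add: parcs_forbidden ex_label)
  then have uy: "d u y = 3" using iso unfolding defs by simp
  have "d u v = 1" "d w y = 1" "d v y = 2" "d u w = 2" "d u a = 2"
    using d_adj d_eq_2I[of v y a] d_eq_2I[of u w b] d_eq_2I[of u a b] adj non ne by blast+
  note dist = this
  then have "v \<in> I u y" "w \<in> I u y" using V uy by (auto simp: mem_I)
  then have "v \<in> conv G {u, y}" "w \<in> conv G {u, y}" using conv_I conv_base by blast+
  then have "x \<in> conv G {u, y}" using conv_common_neighbour[of v _ w x] ne adj non by blast
  then have "x \<in> shadow G x u" "y \<in> shadow G x u" using V by (auto simp: mem_shadow conv_base)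
  then have "x \<in> conv G {u, a}" using shadow_convexD[OF assms, of u x x y a] V ne adj non by blast
  then have "x \<in> I u a" using conv_two V dist by blast
  then show False using I_two[of u a] V dist ne non by auto
qed

end

section \<open>Local convexity in weakly modular graphs\<close>

locale weakly_modular_graph = connected_graph +
  assumes weakly_modular: "weakly_modular G"
begin

lemma TC:
  assumes "u \<sim> v" "s \<in> V" "d s u = d s v"
  obtains x where "x \<sim> u" "x \<sim> v" "d s x + 1 = d s u"
proof -
  have V: "u \<in> V" "v \<in> V" using assms(1) adj_verts by blast+
  then have "d u s = d v s" using assms d_sym by metis
  then show thesis
    using weakly_modular V assms d_adj[of u v] adj_sym that
    unfolding weakly_modular_def triangle_condition_def by metis
qed

lemma QC:
  assumes "u \<sim> w" "v \<sim> w" "u \<noteq> v" "\<not> u \<sim> v" "s \<in> V" "d s u = d s v" "d s w = d s u + 1"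
  obtains x where "x \<sim> u" "x \<sim> v" "d s x + 1 = d s u"
proof -
  have V: "u \<in> V" "v \<in> V" "w \<in> V" using assms adj_verts by blast+
  have "d u w = 1" "d v w = 1" "d u v = 2"
    using assms d_adj d_eq_2I[of u v w] adj_sym by blast+
  then show thesis
    using weakly_modular V assms adj_sym that
    unfolding weakly_modular_def quadrangle_condition_def by metis
qed

end

context connected_graph
begin

definition two_convex :: "'a set \<Rightarrow> bool" where
  "two_convex A \<longleftrightarrow>
    (\<forall>x\<in>A. \<forall>y\<in>A. \<forall>z. x \<noteq> y \<and> \<not> x \<sim> y \<and> x \<sim> z \<and> z \<sim> y \<longrightarrow> z \<in> A)"

lemma two_convexD:
  "two_convex A \<Longrightarrow> x \<in> A \<Longrightarrow> y \<in> A \<Longrightarrow> x \<noteq> y \<Longrightarrow> \<not> x \<sim> y \<Longrightarrow> x \<sim> z \<Longrightarrow> z \<sim> y \<Longrightarrow> z \<in> A"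
  unfolding two_convex_def by blast

text \<open>The usual way to see that two vertices are distinct and nonadjacent: their distances from a common
  base point differ by at least two.\<close>

lemma far_levels:
  assumes "s \<in> V" "d s a + 2 \<le> d s b" shows "a \<noteq> b" "\<not> a \<sim> b" "\<not> b \<sim> a"
  using assms d_adj_le[of s a b] d_adj_le[of s b a] by fastforce+

end

context weakly_modular_graph
begin

text \<open>Let \<open>z'\<close> be the last vertex before \<open>y\<close> on a shortest path from \<open>x\<close> through \<open>z\<close>. Weak modularity
  gives a common neighbour \<open>p\<close> of \<open>z'\<close> and \<open>y'\<close> closer to \<open>x\<close>. It lies in \<open>I x y'\<close> and hence in \<open>A\<close>, it
  is at distance two from \<open>y\<close>, and \<open>z'\<close> lies between \<open>p\<close> and \<open>y\<close>; so \<open>z'\<close> is in \<open>A\<close> and the argument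
  descends to the edge \<open>p z'\<close>.\<close>

lemma two_convex_extend_up:
  assumes A: "two_convex A" and x: "x \<in> V"
    and y: "y' \<sim> y" "y \<in> A" "I x y' \<subseteq> A" "d x y = d x y' + 1"
  shows "I x y \<subseteq> A"
  using y
proof (induction "d x y'" arbitrary: y y' rule: less_induct)
  case less
  have V: "y \<in> V" "y' \<in> V" using less.prems adj_verts by blast+
  show ?case
  proof
    fix z assume z: "z \<in> I x y"
    then have zV: "z \<in> V" and zxy: "d x z + d z y = d x y" by (auto simp: mem_I)
    show "z \<in> A"
    proof (cases "z = y")
      case False
      then obtain z' where z': "z' \<sim> y" "d z z' + 1 = d z y" using closer_neighbour zV V by blast
      have z'V: "z' \<in> V" using z' adj_verts by blast
      have level: "d x z' = d x y'" and z_z': "z \<in> I x z'"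
        using d_triangle[OF x zV z'V] d_adj_le[OF x z'(1)] z'(2) zxy less.prems(4) zV
        by (auto simp: mem_I)
      show ?thesis
      proof (cases "z' = y'")
        case True
        then show ?thesis using z_z' less.prems by blast
      next
        case False
        obtain p where p: "p \<sim> z'" "p \<sim> y'" "d x p + 1 = d x z'"
        proof (cases "z' \<sim> y'")
          case True
          then show ?thesis using TC[OF True x level] that by blast
        next
          case not_adj: False
          show ?thesis
            by (rule QC[OF z'(1) less.prems(1) False not_adj x level]) (use less.prems level that in auto)
        qed
        have pV: "p \<in> V" using p adj_verts by blast
        have pI: "p \<in> I x y'" using p level d_adj[of p y'] pV by (auto simp: mem_I)
        then have pA: "p \<in> A" "I x p \<subseteq> A" using less.prems(3) I_trans[OF x V(2) pI] by blast+
        have "p \<noteq> y" "\<not> p \<sim> y" using far_levels[OF x, of p y] p less.prems(4) level by auto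
        then have z'A: "z' \<in> A" using two_convexD[OF A pA(1) less.prems(2)] p z' by blast
        have "I x z' \<subseteq> A"
          using less.hyps[of p z'] p z'A pA level by simp
        then show ?thesis using z_z' by blast
      qed
    qed (use less.prems in simp)
  qed
qed

lemma two_convex_extend:
  assumes A: "two_convex A" and x: "x \<in> V"
    and y: "y' \<sim> y" "y \<in> A" "I x y' \<subseteq> A"
  shows "I x y \<subseteq> A"
proof -
  have V: "y \<in> V" "y' \<in> V" using y adj_verts by blast+
  consider "d x y = d x y' + 1" | "d x y' = d x y" | "d x y + 1 = d x y'"
    using d_adj_le[OF x y(1)] by linarith
  then show ?thesis
  proof cases
    case 1
    then show ?thesis using two_convex_extend_up[OF A x y] by blast
  next
    case 2
    obtain p where p: "p \<sim> y'" "p \<sim> y" "d x p + 1 = d x y'" by (rule TC[OF y(1) x 2])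
    then have "p \<in> I x y'" using d_adj[of p y'] adj_verts[of p y'] by (simp add: mem_I)
    then have "I x p \<subseteq> A" using I_trans[OF x V(2)] y by blast
    then show ?thesis using two_convex_extend_up[OF A x p(2) y(2)] p 2 by simp
  next
    case 3
    then have "y \<in> I x y'" using d_adj[of y y'] adj_sym[OF y(1)] V by (simp add: mem_I)
    then show ?thesis using I_trans[OF x V(2)] y by blast
  qed
qed

text \<open>The local criterion for convexity that is used for intervals and for shadows. The set of those
  \<open>y\<close> with \<open>I x y \<subseteq> A\<close> contains the centre \<open>c\<close> and is closed under passing to a neighbour in \<open>A\<close>, so
  it reaches all of \<open>A\<close> along shortest paths from \<open>c\<close>. A centre replaces the customary assumption
  that \<open>A\<close> induces a connected subgraph.\<close>

lemma convex_if_starshaped_two_convex: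
  assumes c: "c \<in> V" and star: "\<And>y. y \<in> A \<Longrightarrow> I c y \<subseteq> A" and AV: "A \<subseteq> V"
    and A: "two_convex A"
  shows "geod_convex G A"
proof -
  have "I x y \<subseteq> A" if x: "x \<in> A" and y: "y \<in> A" for x y
    using y
  proof (induction "d c y" arbitrary: y)
    case 0
    then have "y = c" using d_eq_0_iff[of c y] c AV by auto
    then show ?case using star[OF x] I_sym[of x c] x AV c by auto
  next
    case (Suc n)
    have V: "x \<in> V" "y \<in> V" "c \<noteq> y" using x Suc AV c by auto
    then obtain y' where y': "y' \<sim> y" "d c y' + 1 = d c y" using closer_neighbour c by blast
    then have "y' \<in> I c y" using d_adj[of y' y] adj_verts[of y' y] by (simp add: mem_I)
    then have "y' \<in> A" using star Suc.prems by blast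
    then have "I x y' \<subseteq> A" using Suc y' by simp
    then show ?case using two_convex_extend[OF A V(1) y'(1) Suc.prems] by blast
  qed
  then show ?thesis using AV unfolding geod_convex_def by blast
qed

end

section \<open>Convexity of intervals\<close>

locale pre_median_graph = weakly_modular_graph + W4_minus_K23_free_graph

context pre_median_graph
begin

text \<open>The one configuration in which local convexity of \<open>I u v\<close> does not follow from the absence of
  \<open>K_{2,3}\<close> and \<open>W_4\<^sup>-\<close>: \<open>x\<close> and \<open>y\<close> lie on consecutive levels of \<open>I u v\<close>, and their common neighbour
  \<open>z\<close> is as far from \<open>u\<close> as \<open>y\<close> and as far from \<open>v\<close> as \<open>x\<close>, hence outside \<open>I u v\<close>.\<close>

definition corner :: "'a \<Rightarrow> 'a \<Rightarrow> 'a \<Rightarrow> 'a \<Rightarrow> 'a \<Rightarrow> bool" where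
  "corner u v x y z \<longleftrightarrow> u \<in> V \<and> v \<in> V \<and> x \<sim> z \<and> y \<sim> z \<and> x \<noteq> y \<and> \<not> x \<sim> y \<and>
    d u x + d v x = d u v \<and> d u y + d v y = d u v \<and>
    d u y = d u x + 1 \<and> d u z = d u y \<and> d v z = d v x"

lemma corner_sym: "corner u v x y z \<Longrightarrow> corner v u y x z"
  unfolding corner_def using d_sym[of u v] adj_sym[of y x] by auto

lemma level_sum: "u \<in> V \<Longrightarrow> v \<in> V \<Longrightarrow> w \<in> V \<Longrightarrow> d u v \<le> d u w + d v w"
  using d_triangle[of u w v] d_sym[of v w] by simp

lemma corner_lower_level:
  assumes c: "corner u v x y z" and p: "p \<sim> y" "d u p = d u x" shows "d v p = d v x"
  using level_sum[of u v p] d_adj_le[of v p y] c p adj_verts[of p y] unfolding corner_def by simp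

text \<open>If \<open>p\<close> and \<open>x\<close> were not adjacent, the quadrangle condition, applied once from \<open>u\<close> and once from
  \<open>v\<close>, would give them common neighbours \<open>r\<close> below and \<open>w\<close> above their level, besides \<open>z\<close>. As \<open>r\<close> is
  adjacent neither to \<open>z\<close> nor to \<open>w\<close>, these are three common neighbours with at most one edge.\<close>

lemma corner_lower_neighbour:
  assumes c: "corner u v x y z" and p: "p \<sim> z" "p \<sim> y" "d u p = d u x"
  shows "p \<sim> x"
proof (rule ccontr)
  assume np: "\<not> p \<sim> x"
  then have nxp: "\<not> x \<sim> p" using adj_sym by blast
  have V: "u \<in> V" "v \<in> V" and xz: "x \<sim> z" and nxy: "\<not> x \<sim> y"
    and lev: "d u x + d v x = d u v" "d u z = d u x + 1" "d v z = d v x"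
    using c unfolding corner_def by auto
  have xp: "x \<noteq> p" using p nxy by blast
  have vp: "d v p = d v x" using corner_lower_level[OF c p(2,3)] .
  obtain r where r: "r \<sim> x" "r \<sim> p" "d u r + 1 = d u x"
    by (rule QC[OF xz p(1) xp nxp V(1)]) (use p lev in auto)
  have rV: "r \<in> V" using r adj_verts by blast
  have vr: "d v r = d v x + 1"
    using level_sum[OF V rV] d_adj_le[OF V(2) r(1)] r lev by simp
  obtain w where w: "w \<sim> x" "w \<sim> p" "d v w + 1 = d v x"
    by (rule QC[of x r p v]) (use r adj_sym V vp vr xp nxp in auto)
  have uw: "d u w \<ge> d u x + 1" using level_sum[OF V, of w] w adj_verts[of w x] lev by simp
  have "r \<noteq> z" "\<not> z \<sim> r" using far_levels[OF V(1), of r z] r lev by auto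
  moreover have "w \<noteq> r" "\<not> w \<sim> r" using far_levels[OF V(1), of r w] r uw by auto
  moreover have "w \<noteq> z" using w lev by auto
  ultimately show False
    using nonadjacent_common_neighbours(2)[OF xp nxp, of z r w] xz p r w adj_sym by blast
qed

text \<open>The five vertices \<open>x, w, q, y, z\<close> span a \<open>K_5\<close> without the edge \<open>xy\<close>. The triangle condition
  attaches a triangle to \<open>xw\<close> towards \<open>u\<close> and a triangle to \<open>yq\<close> towards \<open>v\<close>; their tips are at distance
  three, because a shorter connection would shorten the distance between \<open>u\<close> and \<open>v\<close>.\<close>

lemma corner_R1:
  assumes c: "corner u v x y z"
    and w: "w \<sim> x" "w \<sim> y" "w \<sim> z" "d u w = d u x"
    and q: "q \<sim> x" "q \<sim> y" "q \<sim> z" "d v q = d v y"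
    and wq: "w \<sim> q"
  shows "contains_isometric G R1"
proof -
  have V: "u \<in> V" "v \<in> V" and z: "x \<sim> z" "y \<sim> z" and nxy: "x \<noteq> y" "\<not> x \<sim> y"
    and lev: "d u x + d v x = d u v" "d u y + d v y = d u v" "d u y = d u x + 1"
      "d u z = d u x + 1" "d v z = d v x"
    using c unfolding corner_def by auto
  obtain a where a: "a \<sim> x" "a \<sim> w" "d u a + 1 = d u x"
    by (rule TC[OF adj_sym[OF w(1)] V(1)]) (use w in auto)
  obtain b where b: "b \<sim> y" "b \<sim> q" "d v b + 1 = d v y"
    by (rule TC[OF adj_sym[OF q(2)] V(2)]) (use q in auto)
  have abV: "a \<in> V" "b \<in> V" using a b adj_verts by blast+
  have "d u v \<le> d u a + d a b + d b v"
    using d_triangle[of u a v] d_triangle[of a b v] V abV by simp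
  then have "3 \<le> d a b" using a b lev d_sym[of b v] V abV by simp
  moreover have "d a b \<le> 3"
    using d_adj_le[OF abV(1) adj_sym[OF b(2)]] d_adj_le[OF abV(1) wq] d_adj[OF a(2)] by simp
  moreover have "a \<noteq> z" "\<not> a \<sim> z" using far_levels[OF V(1), of a z] a lev by auto
  moreover have "b \<noteq> z" "\<not> b \<sim> z" using far_levels[OF V(2), of b z] b lev by auto
  ultimately show ?thesis
    using a b z nxy w(1-3)[THEN adj_sym] q(1-3)[THEN adj_sym] adj_sym[OF wq]
    by (intro contains_R1I[of a b x w q y z]) simp_all
qed

text \<open>Here \<open>xpyq\<close> is an induced square around \<open>z\<close>, and \<open>r\<close> is the apex of a triangle on \<open>yq\<close> one level
  below, not adjacent to \<open>z\<close> or \<open>x\<close>. The vertices \<open>x\<close> and \<open>r\<close> have a common neighbour \<open>t\<close> below them; the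
  triangle condition for the edge \<open>tr\<close> and the base point \<open>z\<close> produces a vertex \<open>w\<close>, on the level of
  \<open>x\<close> from \<open>u\<close>, that turns out to be adjacent to the whole wheel, so that \<open>corner_R1\<close> applies.\<close>

lemma corner_hollow_R1:
  assumes c: "corner u v x y z" and c': "corner u v p q z"
    and pq: "x \<sim> p" "y \<sim> p" "x \<sim> q" "y \<sim> q" "d u p = d u x" "d v q = d v y"
    and r: "r \<sim> y" "r \<sim> q" "d u r = d u x" "\<not> r \<sim> z" "\<not> r \<sim> x"
  shows "contains_isometric G R1"
proof -
  have V: "u \<in> V" and nxy: "x \<noteq> y" "\<not> x \<sim> y" and "x \<sim> z" "y \<sim> z"
    and "d u y = d u x + 1" "d u z = d u x + 1"
    using c unfolding corner_def by auto
  moreover have npq: "p \<noteq> q" "\<not> p \<sim> q" and "p \<sim> z" "q \<sim> z" and "d u q = d u p + 1"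
    using c' unfolding corner_def by auto
  ultimately have z: "x \<sim> z" "y \<sim> z" "p \<sim> z" "q \<sim> z"
    and lev: "d u y = d u x + 1" "d u z = d u x + 1" "d u q = d u x + 1"
    using pq(5) by simp_all
  have rx: "x \<noteq> r" "\<not> x \<sim> r" using nxy(2) r(1,5) adj_sym by blast+
  have rz: "r \<noteq> z" "r \<noteq> y" using r(3) lev by auto
  have zV: "z \<in> V" using z adj_verts by blast
  have yq: "q \<noteq> y" using pq adj_irrefl by blast
  obtain t where t: "t \<sim> x" "t \<sim> r" "d u t + 1 = d u x"
    by (rule QC[OF pq(3) r(2) rx(1,2) V]) (use r lev in auto)
  have tz: "t \<noteq> z" "\<not> t \<sim> z" "t \<noteq> y" "\<not> t \<sim> y" "t \<noteq> q" "\<not> t \<sim> q"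
    using far_levels[OF V, of t] t lev by auto
  have "d z t = 2" using d_eq_2I[of z t x] tz t z adj_sym by blast
  moreover have "d z r = 2" using d_eq_2I[of z r y] rz r z adj_sym by blast
  ultimately obtain w where w: "w \<sim> t" "w \<sim> r" "d z w + 1 = 2"
    using TC[OF t(2) zV] by metis
  have wV: "w \<in> V" using w adj_verts by blast
  have wz: "w \<sim> z" using w d_eq_1_iff[OF zV wV] adj_sym[of z w] by simp
  have uw: "d u w = d u x"
    using d_adj_le[OF V w(1)] d_adj_le[OF V wz] t lev by simp
  have rp: "\<not> r \<sim> p"
    using nonadjacent_common_neighbours(1)[OF npq, of x y r] r pq nxy rx rz adj_sym by blast
  have wne: "w \<noteq> y" "w \<noteq> q" "w \<noteq> p" "w \<noteq> x" using w tz rp rx adj_sym by blast+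
  \<comment> \<open>Two of the three common neighbours \<open>y, q, w\<close> of \<open>r\<close> and \<open>z\<close> are the edge \<open>yq\<close>; as \<open>r\<close> and \<open>z\<close> are not
    adjacent, \<open>w\<close> is joined to this edge, and then it is a lower neighbour for a corner.\<close>
  have all: "w \<sim> x \<and> w \<sim> y \<and> w \<sim> q"
  proof (cases "w \<sim> y")
    case True
    then have wx: "w \<sim> x" using corner_lower_neighbour[OF c wz] uw by blast
    then show ?thesis
      using True nonadjacent_common_neighbours(2)[OF nxy, of p q w] pq npq wne adj_sym by blast
  next
    case False
    have "q \<sim> w"
      using nonadjacent_common_neighbours(1)[OF rz(1) r(4), of w y q] False r w wz z wne yq adj_sym
      by blast
    then have wq: "w \<sim> q" using adj_sym by blast
    then have "w \<sim> p" using corner_lower_neighbour[OF c' wz] uw pq by simp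
    then show ?thesis
      using wq nonadjacent_common_neighbours[OF npq, of x y w] pq nxy wne adj_sym by blast
  qed
  then show ?thesis
    using corner_R1[OF c, of w q] wz uw pq z adj_sym by blast
qed

text \<open>The triangle condition gives \<open>p\<close> below the edge \<open>zy\<close> seen from \<open>u\<close>, and \<open>q\<close> below the edge \<open>zx\<close>
  seen from \<open>v\<close>. By \<open>corner_lower_neighbour\<close> both are adjacent to \<open>x\<close>, \<open>y\<close> and \<open>z\<close>. If they are adjacent
  to each other, the copy of \<open>R_1\<close> is complete. Otherwise \<open>xpyq\<close> is an induced square around \<open>z\<close>, and
  the apexes \<open>r\<close> below \<open>yq\<close> and \<open>s\<close> below \<open>xp\<close> supply a replacement: either one of them is adjacent to
  \<open>z\<close>, or \<open>corner_hollow_R1\<close> applies to one of them.\<close>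

lemma corner_contains_R1:
  assumes c: "corner u v x y z"
  shows "contains_isometric G R1"
proof -
  have V: "u \<in> V" "v \<in> V" and z: "x \<sim> z" "y \<sim> z" and nxy: "x \<noteq> y" "\<not> x \<sim> y"
    and lev: "d u x + d v x = d u v" "d u y + d v y = d u v" "d u y = d u x + 1"
      "d u z = d u y" "d v z = d v x"
    using c unfolding corner_def by auto
  note c_sym = corner_sym[OF c]
  obtain p where p: "p \<sim> z" "p \<sim> y" "d u p + 1 = d u z"
    by (rule TC[OF adj_sym[OF z(2)] V(1) lev(4)])
  obtain q where q: "q \<sim> z" "q \<sim> x" "d v q + 1 = d v z"
    by (rule TC[OF adj_sym[OF z(1)] V(2) lev(5)])
  have levp: "d u p = d u x" "d v q = d v y" using p q lev by auto
  have px: "p \<sim> x" and qy: "q \<sim> y"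
    using corner_lower_neighbour[OF c p(1,2)] corner_lower_neighbour[OF c_sym q(1,2)] levp by auto
  show ?thesis
  proof (cases "p \<sim> q")
    case True
    then show ?thesis using corner_R1[OF c, of p q] p q px qy levp by blast
  next
    case False
    have levq: "d v p = d v x" "d u q = d u y"
      using corner_lower_level[OF c p(2)] corner_lower_level[OF c_sym q(2)] levp by auto
    then have npq: "p \<noteq> q" using levp lev by auto
    have c': "corner u v p q z"
      using False npq p q V lev levp levq unfolding corner_def by simp
    note c'_sym = corner_sym[OF c']
    obtain r where r: "r \<sim> y" "r \<sim> q" "d u r + 1 = d u y"
      by (rule TC[OF adj_sym[OF qy] V(1)]) (use levq in auto)
    obtain s where s: "s \<sim> x" "s \<sim> p" "d v s + 1 = d v x"
      by (rule TC[OF adj_sym[OF px] V(2)]) (use levq in auto)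
    have levr: "d u r = d u x" "d v s = d v y" using r s lev by auto
    consider "r \<sim> z" | "s \<sim> z" | "\<not> r \<sim> z" "\<not> r \<sim> x" | "\<not> s \<sim> z" "\<not> s \<sim> y"
      | "\<not> r \<sim> z" "\<not> s \<sim> z" "r \<sim> x" "s \<sim> y"
      by blast
    then show ?thesis
    proof cases
      case 1
      then have "r \<sim> x" "r \<sim> p"
        using corner_lower_neighbour[OF c 1] corner_lower_neighbour[OF c' 1] r levr levp by auto
      then show ?thesis using corner_R1[OF c, of r q] 1 r q qy levr levp by blast
    next
      case 2
      then have "s \<sim> y" "s \<sim> q"
        using corner_lower_neighbour[OF c_sym 2] corner_lower_neighbour[OF c'_sym 2] s levr levp
        by auto
      then show ?thesis using corner_R1[OF c, of p s] 2 s p px levr levp adj_sym by blast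
    next
      case 3
      then show ?thesis
        using corner_hollow_R1[OF c c', of r] p q px qy levp levr r adj_sym by blast
    next
      case 4
      then show ?thesis
        using corner_hollow_R1[OF c_sym c'_sym, of s] p q px qy levp levr s adj_sym by blast
    next
      case 5
      \<comment> \<open>Now \<open>z, r, s\<close> are common neighbours of \<open>x\<close> and \<open>y\<close> among which \<open>z\<close> misses both others.\<close>
      have "r \<noteq> z" "s \<noteq> z" "s \<noteq> r"
        using levr lev d_adj_le[OF V(1) s(1)] level_sum[OF V, of s] adj_verts[of s x] s by auto
      then have "s \<sim> z"
        using nonadjacent_common_neighbours(1)[OF nxy, of z r s] 5 z r s adj_sym by blast
      then show ?thesis using 5 by blast
    qed
  qed
qed

text \<open>Seen from \<open>v\<close> and then from \<open>u\<close>, the quadrangle condition gives \<open>x\<close> and \<open>y\<close> common neighbours \<open>q\<close>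
  and \<open>p\<close> closer to \<open>v\<close> and to \<open>u\<close>. They are two levels apart and not adjacent, so any common neighbour
  other than \<open>p\<close> and \<open>q\<close> is adjacent to both; but \<open>z\<close> is too far from \<open>v\<close> to be adjacent to \<open>q\<close>.\<close>

lemma same_level_common_neighbour:
  assumes V: "u \<in> V" "v \<in> V" and xy: "x \<noteq> y" "\<not> x \<sim> y" "x \<sim> z" "y \<sim> z"
    and lev: "d u x + d v x = d u v" "d u y = d u x" "d v y = d v x" "d v z = d v x + 1"
  shows "d u z + 1 = d u x"
proof (rule ccontr)
  assume *: "d u z + 1 \<noteq> d u x"
  then have uz: "d u z \<ge> d u x" using d_adj_le[OF V(1) xy(3)] by simp
  obtain q where q: "q \<sim> x" "q \<sim> y" "d v q + 1 = d v x"
    by (rule QC[OF xy(3,4,1,2) V(2)]) (use lev in auto)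
  have uq: "d u q = d u x + 1"
    using level_sum[OF V, of q] adj_verts[of q x] d_adj_le[OF V(1) q(1)] q lev by simp
  obtain p where p: "p \<sim> x" "p \<sim> y" "d u p + 1 = d u x"
    by (rule QC[OF adj_sym[OF q(1)] adj_sym[OF q(2)] xy(1,2) V(1)]) (use lev uq in auto)
  have "p \<noteq> q" "\<not> p \<sim> q" using far_levels[OF V(1), of p q] p uq by auto
  moreover have "z \<noteq> q" "\<not> z \<sim> q" using far_levels[OF V(2), of q z] q lev by auto
  moreover have "z \<noteq> p" using p uz by auto
  ultimately show False
    using nonadjacent_common_neighbours(2)[OF xy(1,2), of p q z] p q xy adj_sym by blast
qed

text \<open>Every interval is starshaped at its end \<open>u\<close>, so only pairs \<open>x, y\<close> at distance two matter. Their
  levels differ by zero, one or two: \<open>same_level_common_neighbour\<close> settles the first case from the side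
  of \<open>u\<close> or of \<open>v\<close>, a corner is the only failure in the second, and the third is the triangle inequality.\<close>

lemma interval_convex:
  assumes no_R1: "\<not> contains_isometric G R1" and V: "u \<in> V" "v \<in> V"
  shows "geod_convex G (I u v)"
proof (rule convex_if_starshaped_two_convex)
  show "u \<in> V" by fact
  show "I u y \<subseteq> I u v" if "y \<in> I u v" for y using I_trans V that by blast
  show "I u v \<subseteq> V" by (auto simp: mem_I)
  have mem: "w \<in> I u v \<longleftrightarrow> w \<in> V \<and> d u w + d v w = d u v" for w
    using V d_sym by (auto simp: mem_I)
  have key: "z \<in> I u v"
    if x: "x \<in> I u v" and y: "y \<in> I u v" and xy: "x \<noteq> y" "\<not> x \<sim> y" "x \<sim> z" "y \<sim> z"
      and le: "d u x \<le> d u y" for x y z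
  proof (rule ccontr)
    assume "z \<notin> I u v"
    moreover have zV: "z \<in> V" using xy adj_verts by blast
    ultimately have bad: "d u z + d v z > d u v" using level_sum[OF V zV] mem by auto
    have lev: "d u x + d v x = d u v" "d u y + d v y = d u v" using x y mem by auto
    have uv: "d v u = d u v" using d_sym V by blast
    note near = d_adj_le[OF V(1) xy(3)] d_adj_le[OF V(2) xy(3)]
      d_adj_le[OF V(1) xy(4)] d_adj_le[OF V(2) xy(4)]
    consider "d u y = d u x" | "d u y = d u x + 1" | "d u y \<ge> d u x + 2" using le by linarith
    then show False
    proof cases
      case 1
      then have vy: "d v y = d v x" using lev by simp
      consider "d v z = d v x + 1" | "d u z = d u x + 1" using bad lev near by linarith
      then show False
      proof cases
        case a: 1
        then show False
          using same_level_common_neighbour[OF V xy lev(1) 1 vy a] bad lev by simp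
      next
        case a: 2
        have "d v x + d u x = d v u" using lev uv by simp
        from same_level_common_neighbour[OF V(2,1) xy this vy 1 a] show False
          using bad lev a by simp
      qed
    next
      case 2
      then have "d u z = d u y" "d v z = d v x" using bad lev near by linarith+
      then have "corner u v x y z" using 2 V xy lev unfolding corner_def by blast
      then show False using corner_contains_R1 no_R1 by blast
    next
      case 3
      then show False using bad lev near by linarith
    qed
  qed
  show "two_convex (I u v)"
    unfolding two_convex_def
  proof (intro ballI allI impI; elim conjE)
    fix x y z assume "x \<in> I u v" "y \<in> I u v" "x \<noteq> y" "\<not> x \<sim> y" "x \<sim> z" "z \<sim> y"
    then show "z \<in> I u v"
      using key[of x y z] key[of y x z] adj_sym nat_le_linear by metis
  qed
qed

end

section \<open>Convexity of point-shadows\<close>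

text \<open>Convexity of the intervals, rather than the absence of \<open>R_1\<close>, is what the study of shadows
  rests on: the hull of a pair is then its interval, and \<open>I_mono\<close> transports points between
  intervals.\<close>

locale interval_convex_graph = pre_median_graph +
  assumes no_K23_plus: "\<not> contains_isometric G K23_plus"
    and I_convex: "\<lbrakk>u \<in> V; v \<in> V\<rbrakk> \<Longrightarrow> geod_convex G (I u v)"
begin

lemma I_mono: "\<lbrakk>u \<in> V; v \<in> V; x \<in> I u v; y \<in> I u v\<rbrakk> \<Longrightarrow> I x y \<subseteq> I u v"
  using I_convex unfolding geod_convex_def by blast

lemma conv_pair:
  assumes V: "u \<in> V" "v \<in> V" shows "conv G {u, v} = I u v"
proof
  show "conv G {u, v} \<subseteq> I u v"
  proof
    fix z assume "z \<in> conv G {u, v}"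
    then show "z \<in> I u v"
      using I_convex[OF V] endpoint_mem_I[OF V] unfolding mem_conv_iff by blast
  qed
  show "I u v \<subseteq> conv G {u, v}" using conv_I conv_base by blast
qed

text \<open>Write \<open>v/u\<close> for the set of vertices \<open>x\<close> with \<open>v \<in> I u x\<close>. The lemma concerns \<open>x\<close> and \<open>y\<close> in \<open>v/u\<close>
  on the same level, with a common neighbour \<open>z\<close> closer to \<open>u\<close>. Both \<open>v\<close> and \<open>z\<close> are in \<open>I u x\<close>, hence so
  is \<open>I v z\<close>. If \<open>z\<close> were farther from \<open>v\<close> than \<open>y\<close>, this would put \<open>y\<close> into \<open>I u x\<close>. If it were
  equally far, a vertex \<open>q\<close> below the edge \<open>zy\<close>, seen from \<open>v\<close>, would be in \<open>I u x\<close> and so adjacent to \<open>x\<close>;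
  then \<open>x\<close>, \<open>y\<close> and a vertex \<open>s\<close> below \<open>zq\<close> form a propeller with axis \<open>zq\<close>.\<close>

lemma lower_common_neighbour:
  assumes V: "u \<in> V" "v \<in> V" and xy: "x \<noteq> y" "\<not> x \<sim> y" "x \<sim> z" "y \<sim> z"
    and lev: "d u x = d u v + d v x" "d u y = d u v + d v y" "d v y = d v x"
    and z: "d u z + 1 = d u x"
  shows "d v z + 1 = d v x"
proof (rule ccontr)
  assume *: "d v z + 1 \<noteq> d v x"
  have W: "x \<in> V" "y \<in> V" "z \<in> V" using xy adj_verts by blast+
  have yx: "d y x \<noteq> 0" using xy d_eq_0_iff W by auto
  have "v \<in> I u x" "z \<in> I u x" using V W lev z d_adj[of z x] adj_sym[OF xy(3)] by (auto simp: mem_I)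
  then have sub: "I v z \<subseteq> I u x" using I_mono V W by blast
  consider "d v z = d v x + 1" | "d v z = d v y" using d_adj_le[OF V(2) xy(3)] lev * by linarith
  then show False
  proof cases
    case 1
    then have "y \<in> I v z" using W d_adj[OF xy(4)] lev by (simp add: mem_I)
    then have "d u y + d y x = d u x" using sub by (auto simp: mem_I)
    then show False using yx lev by simp
  next
    case 2
    obtain q where q: "q \<sim> z" "q \<sim> y" "d v q + 1 = d v z"
      by (rule TC[OF adj_sym[OF xy(4)] V(2) 2])
    have qV: "q \<in> V" using q adj_verts by blast
    have uq: "d u q = d u z"
      using d_adj_le[OF V(1) q(2)] d_triangle[OF V qV] q lev z 2 by simp
    have "q \<in> I v z" using qV q d_adj[OF q(1)] by (simp add: mem_I)
    then have "d u q + d q x = d u x" using sub by (auto simp: mem_I)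
    then have "d q x = 1" using uq z by linarith
    then have qx: "q \<sim> x" using d_eq_1_iff qV W by blast
    obtain s where s: "s \<sim> z" "s \<sim> q" "d u s + 1 = d u z"
      by (rule TC[OF adj_sym[OF q(1)] V(1)]) (use uq in auto)
    have "s \<noteq> x" "\<not> x \<sim> s" "s \<noteq> y" "\<not> y \<sim> s"
      using far_levels[OF V(1), of s x] far_levels[OF V(1), of s y] s z lev by auto
    then show False
      using contains_K23_plusI[of z x y s q] no_K23_plus xy q qx s adj_sym by blast
  qed
qed

text \<open>The other delicate position of \<open>z\<close>: level with \<open>x\<close> and \<open>y\<close> from \<open>u\<close>, but farther from \<open>v\<close>. The aim
  is a common neighbour \<open>e\<close> of \<open>x\<close> and \<open>y\<close> that is closer to \<open>u\<close> and adjacent to \<open>z\<close>. It contradicts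
  \<open>lower_common_neighbour\<close>, which makes \<open>e\<close> closer to \<open>v\<close> than \<open>x\<close>, two levels below \<open>z\<close>. To obtain it,
  take \<open>r\<close> below \<open>x\<close> and \<open>y\<close> seen from \<open>v\<close>, and \<open>p\<close> below the edge \<open>zx\<close> seen from \<open>u\<close>; then \<open>p\<close> is at distance
  two from both ends of the edge \<open>ry\<close>, and the triangle condition applies with \<open>p\<close> as base point.\<close>

lemma level_common_neighbour:
  assumes V: "u \<in> V" "v \<in> V" and xy: "x \<noteq> y" "\<not> x \<sim> y" "x \<sim> z" "y \<sim> z"
    and lev: "d u x = d u v + d v x" "d u y = d u v + d v y" "d v y = d v x"
    and z: "d u z = d u x"
  shows "d v z = d v x"
proof (rule ccontr)
  assume *: "d v z \<noteq> d v x"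
  have W: "x \<in> V" "y \<in> V" "z \<in> V" using xy adj_verts by blast+
  have vz: "d v z = d v x + 1"
    using d_adj_le[OF V(2) xy(3)] d_triangle[OF V W(3)] * lev z by linarith
  obtain r where r: "r \<sim> x" "r \<sim> y" "d v r + 1 = d v x"
    by (rule QC[OF xy(3,4,1,2) V(2)]) (use lev vz in auto)
  have rV: "r \<in> V" using r adj_verts by blast
  have ur: "d u r + 1 = d u x"
    using d_triangle[OF V rV] d_adj_le[OF V(1) r(1)] r lev by simp
  have rz: "r \<noteq> z" "\<not> r \<sim> z" "\<not> z \<sim> r" using far_levels[OF V(2), of r z] r vz by auto
  obtain p where p: "p \<sim> z" "p \<sim> x" "d u p + 1 = d u z"
    by (rule TC[OF adj_sym[OF xy(3)] V(1) z])
  have pV: "p \<in> V" using p adj_verts by blast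
  have high: "\<not> (e \<sim> x \<and> e \<sim> y \<and> e \<sim> z \<and> d u e + 1 = d u x)" for e
    using lower_common_neighbour[OF V xy(1,2) _ _ lev, of e] d_adj_le[OF V(2), of e z] vz
      adj_sym[of e x] adj_sym[of e y] by auto
  have py: "\<not> p \<sim> y" "p \<noteq> y" using high[of p] p z xy(2) adj_sym[of y x] by auto
  have px: "p \<noteq> x" using p(2) adj_irrefl by blast
  have pr: "\<not> p \<sim> r" "p \<noteq> r"
  proof -
    show "p \<noteq> r" using p(1) rz(2) by blast
    show "\<not> p \<sim> r"
    proof
      assume "p \<sim> r"
      then have "p \<sim> y"
        using nonadjacent_common_neighbours(2)[OF rz(1,2) r(1) adj_sym[OF xy(3)] r(2)
          adj_sym[OF xy(4)] adj_sym adj_sym[OF p(1)] xy(1,2) px py(2)] by blast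
      then show False using py(1) by blast
    qed
  qed
  \<comment> \<open>The vertex \<open>t\<close> is a common neighbour of \<open>p\<close> and \<open>r\<close> not adjacent to \<open>x\<close>; it forces \<open>e\<close> to be adjacent
    to both \<open>x\<close> and \<open>t\<close>, which fixes the level of \<open>e\<close>.\<close>
  obtain t where t: "t \<sim> p" "t \<sim> r" "d u t + 1 = d u p"
    by (rule QC[OF p(2) r(1) pr(2,1) V(1)]) (use p z ur in auto)
  have tfar: "t \<noteq> x" "\<not> x \<sim> t" "t \<noteq> y" "\<not> t \<sim> y"
    using far_levels[OF V(1), of t x] far_levels[OF V(1), of t y] t p z lev by auto
  have "d p r = 2" "d p y = 2"
    using d_eq_2I[OF pr(2,1) p(2) adj_sym[OF r(1)]] d_eq_2I[OF py(2,1) p(1) adj_sym[OF xy(4)]]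
    by blast+
  then obtain e where e: "e \<sim> r" "e \<sim> y" "d p e + 1 = 2"
    using TC[OF r(2) pV] by metis
  have "p \<sim> e" using e d_eq_1_iff[OF pV, of e] adj_verts[of e r] by simp
  then have ep: "e \<sim> p" by (rule adj_sym)
  have ene: "e \<noteq> x" "e \<noteq> t" "e \<noteq> r" "e \<noteq> z"
    using e(1,2) xy(2) tfar rz adj_irrefl by blast+
  have ex_et: "e \<sim> x" "e \<sim> t"
    using nonadjacent_common_neighbours[OF pr(2,1) p(2) r(1) adj_sym[OF t(1)] adj_sym[OF t(2)]
      adj_sym[OF ep] adj_sym[OF e(1)] not_sym[OF tfar(1)] tfar(2) ene(1,2)] by blast+
  have "d u e + 1 = d u x"
    using d_adj_le[OF V(1) ex_et(2)] d_adj_le[OF V(1) e(2)] t p z lev by simp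
  moreover have "e \<sim> z"
    using nonadjacent_common_neighbours(2)[OF xy(1,2) adj_sym[OF r(1)] adj_sym[OF r(2)] xy(3,4)
      adj_sym[OF ex_et(1)] adj_sym[OF e(2)] rz(1,2) ene(3,4)] .
  ultimately show False using high ex_et e by blast
qed

text \<open>A shadow \<open>v/u\<close> is starshaped at \<open>v\<close>, so again only pairs \<open>x, y\<close> at distance two with a common
  neighbour \<open>z\<close> matter, and the preceding lemmas treat pairs on the same level. On consecutive
  levels, a failure would put \<open>x\<close> into \<open>I v z\<close> and thus into \<open>I u y\<close>, too close to \<open>u\<close> for a vertex
  that is not adjacent to \<open>y\<close>.\<close>

lemma shadow_convex:
  assumes V: "u \<in> V" "v \<in> V"
  shows "geod_convex G (shadow G v u)"
proof (rule convex_if_starshaped_two_convex)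
  show "v \<in> V" by fact
  show "shadow G v u \<subseteq> V" by (auto simp: mem_shadow)
  have mem: "x \<in> shadow G v u \<longleftrightarrow> x \<in> V \<and> d u x = d u v + d v x" for x
  proof (cases "x \<in> V")
    case True
    then have "x \<in> shadow G v u \<longleftrightarrow> v \<in> I u x" by (simp add: mem_shadow conv_pair V)
    also have "\<dots> \<longleftrightarrow> d u x = d u v + d v x" using V by (simp add: mem_I eq_commute)
    finally show ?thesis using True by blast
  qed (simp add: mem_shadow)
  show "I v y \<subseteq> shadow G v u" if y: "y \<in> shadow G v u" for y
  proof
    fix z assume z: "z \<in> I v y"
    have W: "y \<in> V" "z \<in> V" "d v z + d z y = d v y" "d u y = d u v + d v y"
      using y z mem by (auto simp: mem_I)
    then show "z \<in> shadow G v u"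
      using d_triangle[OF V W(2)] d_triangle[OF V(1) W(2,1)] mem by simp
  qed
  have key: "z \<in> shadow G v u"
    if x: "x \<in> shadow G v u" and y: "y \<in> shadow G v u"
      and xy: "x \<noteq> y" "\<not> x \<sim> y" "x \<sim> z" "y \<sim> z" and le: "d v x \<le> d v y" for x y z
  proof -
    have W: "x \<in> V" "y \<in> V" "z \<in> V" using xy adj_verts by blast+
    have lev: "d u x = d u v + d v x" "d u y = d u v + d v y" using x y mem by auto
    note near = d_adj_le[OF V(1) xy(3)] d_adj_le[OF V(2) xy(3)]
      d_adj_le[OF V(1) xy(4)] d_adj_le[OF V(2) xy(4)] d_triangle[OF V W(3)]
    have "d u z = d u v + d v z"
    proof (rule ccontr)
      assume ne: "d u z \<noteq> d u v + d v z"
      consider "d v y = d v x" | "d v y = d v x + 1" | "d v y \<ge> d v x + 2" using le by linarith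
      then show False
      proof cases
        case 1
        consider "d u z + 1 = d u x" | "d u z = d u x" | "d u z = d u x + 1"
          using near by linarith
        then show False
          using lower_common_neighbour[OF V xy lev 1] level_common_neighbour[OF V xy lev 1]
            near lev ne by cases linarith+
      next
        case 2
        then have bad: "d u z = d u x" "d v z = d v x + 1" using near lev ne by linarith+
        have "v \<in> I u y" "z \<in> I u y"
          using V W lev 2 bad d_adj[OF adj_sym[OF xy(4)]] by (auto simp: mem_I)
        then have "I v z \<subseteq> I u y" using I_mono V W by blast
        moreover have "x \<in> I v z" using W bad d_adj[OF xy(3)] by (simp add: mem_I)
        ultimately have "d u x + d x y = d u y" by (auto simp: mem_I)
        then have "d x y = 1" using lev 2 by linarith
        then show False using d_eq_1_iff W xy by blast
      next
        case 3
        then show False using near lev ne by linarith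
      qed
    qed
    then show ?thesis using W mem by blast
  qed
  show "two_convex (shadow G v u)"
    unfolding two_convex_def
  proof (intro ballI allI impI; elim conjE)
    fix x y z assume "x \<in> shadow G v u" "y \<in> shadow G v u" "x \<noteq> y" "\<not> x \<sim> y" "x \<sim> z" "z \<sim> y"
    then show "z \<in> shadow G v u"
      using key[of x y z] key[of y x z] adj_sym nat_le_linear by metis
  qed
qed

end

section \<open>The characterization\<close>

theorem theorem2:
  fixes G :: "'a pair_pre_digraph"
  assumes "connected_simple_graph G"
    and "weakly_modular G"
  shows "strongly_smooth G \<longleftrightarrow>
    \<not> contains_isometric G W4_minus \<and> \<not> contains_isometric G K23 \<and>
    \<not> contains_isometric G K23_plus \<and> \<not> contains_isometric G R1"
proof -
  interpret connected_graph G
    using assms(1) by (rule connected_simple_graph_imp_connected_graph)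
  show ?thesis
  proof
    assume "strongly_smooth G"
    then show "\<not> contains_isometric G W4_minus \<and> \<not> contains_isometric G K23 \<and>
        \<not> contains_isometric G K23_plus \<and> \<not> contains_isometric G R1"
      using strongly_smooth_no_W4_minus strongly_smooth_no_K23 strongly_smooth_no_K23_plus
        strongly_smooth_no_R1 by blast
  next
    assume free: "\<not> contains_isometric G W4_minus \<and> \<not> contains_isometric G K23 \<and>
        \<not> contains_isometric G K23_plus \<and> \<not> contains_isometric G R1"
    interpret pre_median_graph G by unfold_locales (use assms(2) free in auto)
    interpret interval_convex_graph G by unfold_locales (use free interval_convex in auto)
    show "strongly_smooth G" unfolding strongly_smooth_def using shadow_convex by blast
  qed
qed

end
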